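(* Let $M\ge 2$ be an integer. Let $X=(X(t))_{t\in\mathbb{R}}$ be a real, centred, second-order wide-sense stationary random process, continuous in quadratic mean. Assume that the spectrum $\gamma$ of $X$ belongs to $L^{\infty}(\mathbb{R})$ and is supported within $[-\pi,\pi]$. Let $\lambda=(m_\ell)_{\ell\ge 1}$ be a sequence of elements of $\{0,1,\ldots,M-1\}$, let $n_\lambda(j)=\sum_{\ell=1}^{j} m_\ell M^{j-\ell}$ for $j\geq 1$, and let $R^{S}_{j,n_\lambda(j)}$ denote the autocorrelation function of the Shannon $M$-band wavelet packet coefficients $c^{S}_{j,n_\lambda(j)}$ of $X$ at node $(j,n_\lambda(j))$. Let $$\omega_\lambda=\lim_{j\to+\infty}\frac{G(n_\lambda(j))\,\pi}{M^{j}} .$$ If $\gamma$ is continuous at the point $\omega_\lambda$, then $$\lim_{j\to+\infty} R^{S}_{j,n_\lambda(j)}[k]=\gamma(\omega_\lambda)\,\delta[k]$$ uniformly in $k\in\mathbb{Z}$, where $\delta[0]=1$ and $\delta[k]=0$ for $k\neq 0$.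
   Context: Fourier transform: $\mathcal{F}f(\omega)=\int_{\mathbb{R}} f(t)e^{-i\omega t}\,dt$. The autocorrelation function of $X$ is $R(t-s)=\mathbb{E}[X(t)X(s)]$; the spectrum $\gamma$ is the Fourier transform of $R$ (assumed to exist). Shannon $M$-band filters: for $m\in\{0,\ldots,M-1\}$, $H^{S}_m(\omega)=\sum_{\ell\in\mathbb{Z}}\mathbf{1}_{\Delta_m}(\omega-2\pi\ell)$ with $\Delta_m=\left[-\frac{(m+1)\pi}{M},-\frac{m\pi}{M}\right]\cup\left[\frac{m\pi}{M},\frac{(m+1)\pi}{M}\right]$. Shannon wavelet packet functions: every $n\in\{0,\ldots,M^j-1\}$ is written uniquely as $n=\sum_{\ell=1}^{j}m_\ell M^{j-\ell}$ with $m_\ell\in\{0,\ldots,M-1\}$, and $W^{S}_{j,n}\in L^2(\mathbb{R})$ is the function with Fourier transform (a.e.) $$\mathcal{F}W^{S}_{j,n}(\omega)=M^{j/2}\Big[\prod_{\ell=1}^{j}H^{S}_{m_\ell}(M^{\ell-1}\omega)\Big]\mathbf{1}_{[-\pi,\pi]}(\omega).$$ For $k\in\mathbb{Z}$, $W^{S}_{j,n,k}$ is defined by $\mathcal{F}W^{S}_{j,n,k}(\omega)=e^{-iM^{j}k\omega}\mathcal{F}W^{S}_{j,n}(\omega)$, i.e. $W^{S}_{j,n,k}(t)=W^{S}_{j,n}(t-M^jk)$. The coefficients at node $(j,n)$ are $c^{S}_{j,n}[k]=\int_{\mathbb{R}}X(t)W^{S}_{j,n,k}(t)\,dt$, $k\in\mathbb{Z}$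 (the integrals are assumed to exist in the second-order sense). The process $(c^{S}_{j,n}[k])_k$ is wide-sense stationary, and its autocorrelation function $R^{S}_{j,n}[k-\ell]=\mathbb{E}[c^{S}_{j,n}[k]c^{S}_{j,n}[\ell]]$ is given by $$R^{S}_{j,n}[k]=\frac{1}{2\pi}\int_{\mathbb{R}}\gamma(\omega)\,|\mathcal{F}W^{S}_{j,n}(\omega)|^2e^{iM^{j}k\omega}\,d\omega .$$ The map $G:\mathbb{N}\to\mathbb{N}$ is defined recursively by $G(0)=0$ and, for $m\in\{0,\ldots,M-1\}$ and $\ell\ge 0$, $G(M\ell+m)=MG(\ell)+m$ if $G(\ell)$ is even, and $G(M\ell+m)=MG(\ell)-m+M-1$ if $G(\ell)$ is odd. The intervals $\left[\frac{G(n_\lambda(j))\pi}{M^j},\frac{(G(n_\lambda(j))+1)\pi}{M^j}\right]$, $j\ge1$, are nested, so the limit defining $\omega_\lambda$ exists. *)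

theory Defs
  imports "HOL-Probability.Probability"
begin

section \<open>Square-integrable functions and convergence in square mean\<close>

definition square_integrable :: "'a measure \<Rightarrow> ('a \<Rightarrow> 'b::real_normed_vector) \<Rightarrow> bool" where
  "square_integrable M f \<longleftrightarrow> f \<in> borel_measurable M \<and> integrable M (\<lambda>x. (norm (f x))\<^sup>2)"

text \<open>The nonnegative integral is used here because the Bochner integral of a non-integrable
  function is \<open>0\<close>.\<close>

definition tendsto_L2 ::
    "'a measure \<Rightarrow> ('i \<Rightarrow> 'a \<Rightarrow> 'b::real_normed_vector) \<Rightarrow> ('a \<Rightarrow> 'b) \<Rightarrow> 'i filter \<Rightarrow> bool" where
  "tendsto_L2 M f g F \<longleftrightarrow>
     ((\<lambda>i. \<integral>\<^sup>+x. ennreal ((norm (f i x - g x))\<^sup>2) \<partial>M) \<longlongrightarrow> 0) F"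


section \<open>Fourier transform\<close>

text \<open>The Fourier transform on \<open>L\<^sup>2(\<real>)\<close> with kernel \<open>exp (- \<i> \<omega> t)\<close>: the limit in square mean of the
  integrals over \<open>[-T, T]\<close>.  It is a relation because the transform is determined only up to
  equality almost everywhere.\<close>

definition has_fourier_transform :: "(real \<Rightarrow> complex) \<Rightarrow> (real \<Rightarrow> complex) \<Rightarrow> bool" where
  "has_fourier_transform f g \<longleftrightarrow>
     square_integrable lebesgue f \<and> square_integrable lebesgue g \<and>
     tendsto_L2 lebesgue
       (\<lambda>T \<omega>. LINT t:{-T..T}|lebesgue. f t * exp (- (\<i> * complex_of_real (\<omega> * t)))) g at_top"


section \<open>Second-order processes\<close>

text \<open>The definition of \<open>autocorrelation\<close> is \<open>E[Y(t) Y(s)] = R(t - s)\<close> at \<open>s = 0\<close>; for a wide-sense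
  stationary process this is the identity for all \<open>s\<close> and \<open>t\<close>.  The index group is \<open>\<real>\<close> for the
  process and \<open>\<int>\<close> for its wavelet packet coefficients.\<close>

definition autocorrelation ::
    "'a measure \<Rightarrow> ('i::group_add \<Rightarrow> 'a \<Rightarrow> real) \<Rightarrow> 'i \<Rightarrow> real" where
  "autocorrelation P Y k = (\<integral>x. Y k x * Y 0 x \<partial>P)"

definition wide_sense_stationary ::
    "'a measure \<Rightarrow> ('i::group_add \<Rightarrow> 'a \<Rightarrow> real) \<Rightarrow> bool" where
  "wide_sense_stationary P Y \<longleftrightarrow>
     (\<forall>t. square_integrable P (Y t)) \<and>
     (\<exists>\<mu>. \<forall>t. (\<integral>x. Y t x \<partial>P) = \<mu>) \<and>
     (\<forall>t s. (\<integral>x. Y t x * Y s x \<partial>P) = autocorrelation P Y (t - s))"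

definition centred :: "'a measure \<Rightarrow> ('i \<Rightarrow> 'a \<Rightarrow> real) \<Rightarrow> bool" where
  "centred P Y \<longleftrightarrow> (\<forall>t. (\<integral>x. Y t x \<partial>P) = 0)"

definition continuous_in_quadratic_mean :: "'a measure \<Rightarrow> (real \<Rightarrow> 'a \<Rightarrow> real) \<Rightarrow> bool" where
  "continuous_in_quadratic_mean P X \<longleftrightarrow> (\<forall>t. tendsto_L2 P X (X t) (at t))"

text \<open>\<open>Y\<close> is the integral of the process \<open>Z\<close> over \<open>[a, b]\<close> in the second-order sense: the limit in
  quadratic mean of Riemann sums.  The limit is along \<open>division_filter\<close>, as for \<open>has_integral\<close>; it
  extends the limit for mesh tending to \<open>0\<close> and does not depend on the choice of a representative
  of an integrand \<open>X(t) f(t)\<close> up to null sets of times \<open>t\<close>.\<close>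

definition has_qm_integral_on ::
    "'a measure \<Rightarrow> (real \<Rightarrow> 'a \<Rightarrow> real) \<Rightarrow> ('a \<Rightarrow> real) \<Rightarrow> real \<Rightarrow> real \<Rightarrow> bool" where
  "has_qm_integral_on P Z Y a b \<longleftrightarrow>
     square_integrable P Y \<and>
     tendsto_L2 P (\<lambda>D x. \<Sum>(t, K)\<in>D. measure lborel K * Z t x) Y (division_filter (cbox a b))"

text \<open>Over \<open>\<real>\<close> the integral is improper, since wavelet packet functions need not be absolutely
  integrable.\<close>

definition has_qm_integral ::
    "'a measure \<Rightarrow> (real \<Rightarrow> 'a \<Rightarrow> real) \<Rightarrow> ('a \<Rightarrow> real) \<Rightarrow> bool" where
  "has_qm_integral P Z Y \<longleftrightarrow>
     square_integrable P Y \<and>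
     (\<exists>I. (\<forall>T>0. has_qm_integral_on P Z (I T) (-T) T) \<and> tendsto_L2 P I Y at_top)"


section \<open>Shannon wavelet packets\<close>

definition shannon_band :: "nat \<Rightarrow> nat \<Rightarrow> real set" where
  "shannon_band M m =
     {- (real (m + 1) * pi / real M) .. - (real m * pi / real M)} \<union>
     {real m * pi / real M .. real (m + 1) * pi / real M}"

definition shannon_filter :: "nat \<Rightarrow> nat \<Rightarrow> real \<Rightarrow> real" where
  "shannon_filter M m \<omega> =
     (\<Sum>\<^sub>\<infinity>l\<in>(UNIV::int set). indicator (shannon_band M m) (\<omega> - 2 * pi * of_int l))"

definition node_index :: "nat \<Rightarrow> (nat \<Rightarrow> nat) \<Rightarrow> nat \<Rightarrow> nat" where
  "node_index M m j = (\<Sum>l=1..j. m l * M ^ (j - l))"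

text \<open>\<open>packet_digit M j n l\<close> is the digit of \<open>n\<close> with weight \<open>M ^ (j - l)\<close>; see \<open>node_index_digit\<close>
  and \<open>packet_digit_node_index\<close> below.\<close>

definition packet_digit :: "nat \<Rightarrow> nat \<Rightarrow> nat \<Rightarrow> nat \<Rightarrow> nat" where
  "packet_digit M j n l = (n div M ^ (j - l)) mod M"

definition shannon_packet_ft :: "nat \<Rightarrow> nat \<Rightarrow> nat \<Rightarrow> real \<Rightarrow> real" where
  "shannon_packet_ft M j n \<omega> =
     real M powr (real j / 2) *
     (\<Prod>l=1..j. shannon_filter M (packet_digit M j n l) (real M ^ (l - 1) * \<omega>)) *
     indicator {-pi..pi} \<omega>"

definition shannon_packet :: "nat \<Rightarrow> nat \<Rightarrow> nat \<Rightarrow> (real \<Rightarrow> real) \<Rightarrow> bool" where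
  "shannon_packet M j n w \<longleftrightarrow>
     has_fourier_transform (\<lambda>t. of_real (w t)) (\<lambda>\<omega>. of_real (shannon_packet_ft M j n \<omega>))"

definition packet_coefficients ::
    "'a measure \<Rightarrow> (real \<Rightarrow> 'a \<Rightarrow> real) \<Rightarrow> nat \<Rightarrow> nat \<Rightarrow> (real \<Rightarrow> real) \<Rightarrow> (int \<Rightarrow> 'a \<Rightarrow> real) \<Rightarrow> bool" where
  "packet_coefficients P X M j w c \<longleftrightarrow>
     (\<forall>k. has_qm_integral P (\<lambda>t x. X t x * w (t - real M ^ j * of_int k)) (c k))"

lemma packet_digit_less: "2 \<le> M \<Longrightarrow> packet_digit M j n l < M"
  by (simp add: packet_digit_def)

lemma node_index_Suc: "node_index M m (Suc j) = M * node_index M m j + m (Suc j)"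
proof -
  have "(\<Sum>l=1..j. m l * M ^ (Suc j - l)) = (\<Sum>l=1..j. M * (m l * M ^ (j - l)))"
    by (rule sum.cong) (auto simp: Suc_diff_le)
  then show ?thesis
    by (simp add: node_index_def sum_distrib_left)
qed

lemma node_index_digit:
  assumes "n < M ^ j"
  shows "node_index M (packet_digit M j n) j = n"
  using assms
proof (induction j arbitrary: n)
  case 0
  then show ?case by (simp add: node_index_def)
next
  case (Suc j)
  have *: "packet_digit M (Suc j) n l = packet_digit M j (n div M) l" if "l \<in> {1..j}" for l
    using that by (simp add: packet_digit_def Suc_diff_le div_mult2_eq)
  have "node_index M (packet_digit M (Suc j) n) j = node_index M (packet_digit M j (n div M)) j"
    unfolding node_index_def by (intro sum.cong) (simp_all add: *)
  also have "\<dots> = n div M"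
    using Suc.prems by (intro Suc.IH) (simp add: less_mult_imp_div_less mult.commute)
  finally have "node_index M (packet_digit M (Suc j) n) j = n div M" .
  moreover have "packet_digit M (Suc j) n (Suc j) = n mod M"
    by (simp add: packet_digit_def)
  ultimately show ?case
    by (simp add: node_index_Suc)
qed

lemma packet_digit_node_index:
  assumes "\<And>l. l \<in> {1..j} \<Longrightarrow> m l < M" and "l \<in> {1..j}"
  shows "packet_digit M j (node_index M m j) l = m l"
  using assms
proof (induction j)
  case 0
  then show ?case by simp
next
  case (Suc j)
  have d: "m (Suc j) < M" using Suc.prems by simp
  show ?case
  proof (cases "l = Suc j")
    case True
    then show ?thesis using d by (simp add: packet_digit_def node_index_Suc)
  next
    case False
    then have l: "l \<in> {1..j}" using Suc.prems by auto
    have "packet_digit M (Suc j) (node_index M m (Suc j)) l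
        = packet_digit M j (node_index M m j) l"
      using l d by (simp add: packet_digit_def Suc_diff_le div_mult2_eq node_index_Suc)
    then show ?thesis using Suc l by auto
  qed
qed


section \<open>Frequency ordering\<close>

function packet_perm :: "nat \<Rightarrow> nat \<Rightarrow> nat" where
  "packet_perm M n =
     (if n = 0 \<or> M < 2 then 0
      else if even (packet_perm M (n div M)) then M * packet_perm M (n div M) + n mod M
      else M * packet_perm M (n div M) - n mod M + M - 1)"
  by auto
termination by (relation "Wellfounded.measure snd") auto

declare packet_perm.simps [simp del]

lemma packet_perm_0: "packet_perm M 0 = 0"
  by (simp add: packet_perm.simps)

lemma packet_perm_rec:
  assumes "2 \<le> M" "m < M"
  shows "packet_perm M (M * l + m) =
    (if even (packet_perm M l) then M * packet_perm M l + m
     else M * packet_perm M l - m + M - 1)"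
  using assms by (cases "M * l + m = 0") (auto simp: packet_perm.simps[of M "M * l + m"] packet_perm_0)

definition path_frequency :: "nat \<Rightarrow> (nat \<Rightarrow> nat) \<Rightarrow> real" where
  "path_frequency M m = lim (\<lambda>j. real (packet_perm M (node_index M m j)) * pi / real M ^ j)"

end

theory Submission
  imports Defs
begin

text \<open>Pairing the process with a fixed \<open>V \<in> L\<^sup>2(P)\<close> turns a quadratic mean integral into an
  ordinary gauge integral, so that Fubini's theorem expresses \<open>E[c\<^sub>k c\<^sub>0]\<close> through Fourier integrals of
  the packets truncated to \<open>[-T, T]\<close>; since \<open>\<gamma>\<close> is bounded, \<open>T \<longrightarrow> \<infinity>\<close> yields the spectral formula for
  \<open>R\<^sub>j[k]\<close>.  Plancherel's theorem is not used: \<open>R\<close> is recovered from \<open>\<gamma>\<close> by Gaussian summation, and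
  the shift by \<open>M\<^sup>j k\<close> moves the truncation window only by a bounded amount, where the packet has
  vanishing \<open>L\<^sup>1\<close> norm.  Since \<open>|\<F> W\<^sub>j|\<^sup>2\<close> is \<open>M\<^sup>j\<close> times the indicator of \<open>\<plusminus>[G \<pi> / M\<^sup>j, (G + 1) \<pi> / M\<^sup>j]\<close>
  and \<open>\<gamma>\<close> is even, \<open>R\<^sub>j[k]\<close> is the mean of \<open>\<gamma>(\<omega>) cos (M\<^sup>j k \<omega>)\<close> over an interval that contains
  \<open>\<omega>\<^sub>\<lambda>\<close> and shrinks to it, and the mean of the cosine over that interval is exactly \<open>\<delta>[k]\<close>.\<close>

section \<open>Limits in square mean\<close>

text \<open>The sharp cutoffs in frequency make a packet decay in time only like 1/|t|: it is square
  integrable without being integrable, so integrals over the whole line cannot be exchanged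
  directly. On \<open>[-T, T]\<close> everything converges absolutely, and T is sent to infinity in
  two L2 spaces, over the probability space and over the frequencies. A shift in time adds an error
  bounded by a small constant in \<omega>, and a constant is not square integrable; the spectrum,
  bounded and square integrable, is the weight that controls this error together with the L2 error.
  The parity rule in G comes from aliasing: for an even filter of period 2 pi, the interval
  \<open>[q pi, (q + 1) pi]\<close> with odd q is a mirror image of \<open>[0, pi]\<close>, so its M
  sub-bands appear in reverse order. Evenness of \<gamma> is essential because continuity is assumed
  at \<open>path_frequency M m\<close> and not at its negative. Uniformity in k holds because
  freezing \<gamma> on the band costs at most its oscillation there, |cos| being at most 1 for every
  k.\<close>

text \<open>Cauchy-Schwarz for nonnegative integrals controls the square of an integral; comparison
  with \<open>e\<^sup>2\<close> extracts the root without taking one in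
  \<open>ennreal\<close>.\<close>

lemma ennreal_tendsto_0_square_bound:
  fixes X Y :: "'i \<Rightarrow> ennreal"
  assumes "\<And>i. (X i)\<^sup>2 \<le> Y i" and Y: "(Y \<longlongrightarrow> 0) F"
  shows "(X \<longlongrightarrow> 0) F"
proof (rule order_tendstoI)
  fix e :: ennreal assume "0 < e"
  then have "0 < e\<^sup>2" by (simp add: power2_eq_square ennreal_zero_less_mult_iff)
  then have "\<forall>\<^sub>F i in F. Y i < e\<^sup>2" using Y by (metis order_tendstoD(2))
  then show "\<forall>\<^sub>F i in F. X i < e"
  proof eventually_elim
    case (elim i)
    then have "(X i)\<^sup>2 < e\<^sup>2" using assms(1)[of i] by (rule le_less_trans[rotated])
    then show ?case by (meson power_mono not_le zero_le)
  qed
qed auto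

lemma square_integrable_nn_finite:
  assumes "square_integrable M f" shows "(\<integral>\<^sup>+x. ennreal ((norm (f x))\<^sup>2) \<partial>M) < \<infinity>"
  using assms unfolding square_integrable_def integrable_iff_bounded by auto

lemma square_integrable_mult:
  fixes f g :: "'a \<Rightarrow> 'b::{real_normed_algebra, banach, second_countable_topology}"
  assumes f: "square_integrable M f" and g: "square_integrable M g"
  shows "integrable M (\<lambda>x. f x * g x)"
proof (rule Bochner_Integration.integrable_bound)
  have [measurable]: "f \<in> borel_measurable M" "g \<in> borel_measurable M"
    using f g by (auto simp: square_integrable_def)
  show "integrable M (\<lambda>x. (norm (f x))\<^sup>2 + (norm (g x))\<^sup>2)"
    using f g by (auto simp: square_integrable_def)
  show "(\<lambda>x. f x * g x) \<in> borel_measurable M" by measurable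
  have "norm (f x * g x) \<le> norm ((norm (f x))\<^sup>2 + (norm (g x))\<^sup>2)" for x
  proof -
    have "norm (f x * g x) \<le> norm (f x) * norm (g x)" by (rule norm_mult_ineq)
    also have "\<dots> \<le> (norm (f x))\<^sup>2 + (norm (g x))\<^sup>2"
      using sum_squares_bound[of "norm (f x)" "norm (g x)"] 
        mult_nonneg_nonneg[OF norm_ge_zero[of "f x"] norm_ge_zero[of "g x"]] by linarith
    finally show ?thesis by simp
  qed
  then show "AE x in M. norm (f x * g x) \<le> norm ((norm (f x))\<^sup>2 + (norm (g x))\<^sup>2)" by simp
qed

text \<open>Expand f g - f0 g0 = df dg + f0 dg + df g0 and apply Cauchy-Schwarz to each term. Of the
  approximants only measurability is asked: \<open>f i * g i\<close> is integrable as soon as the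
  error is finite, which happens eventually.\<close>

lemma tendsto_L2_integral_mult:
  fixes f g :: "'i \<Rightarrow> 'a \<Rightarrow> 'b::{real_normed_algebra, banach, second_countable_topology}"
  assumes f: "tendsto_L2 M f f0 F" and g: "tendsto_L2 M g g0 F"
    and f0: "square_integrable M f0" and g0: "square_integrable M g0"
    and [measurable]: "\<And>i. f i \<in> borel_measurable M" "\<And>i. g i \<in> borel_measurable M"
  shows "((\<lambda>i. \<integral>x. f i x * g i x \<partial>M) \<longlongrightarrow> (\<integral>x. f0 x * g0 x \<partial>M)) F"
proof -
  have [measurable]: "f0 \<in> borel_measurable M" "g0 \<in> borel_measurable M"
    using f0 g0 by (auto simp: square_integrable_def)
  define N where "N u v = (\<integral>\<^sup>+x. ennreal (norm (u x)) * ennreal (norm (v x)) \<partial>M)" for u v :: "'a \<Rightarrow> 'b"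
  define Q where "Q u = (\<integral>\<^sup>+x. ennreal ((norm (u x))\<^sup>2) \<partial>M)" for u :: "'a \<Rightarrow> 'b"
  have CS: "(N u v)\<^sup>2 \<le> Q u * Q v" if [measurable]: "u \<in> borel_measurable M" "v \<in> borel_measurable M" for u v
    using Cauchy_Schwarz_nn_integral[of "\<lambda>x. ennreal (norm (u x))" M "\<lambda>x. ennreal (norm (v x))"]
    by (simp add: N_def Q_def ennreal_power)
  let ?df = "\<lambda>i x. f i x - f0 x" and ?dg = "\<lambda>i x. g i x - g0 x"
  have Qf: "((\<lambda>i. Q (?df i)) \<longlongrightarrow> 0) F" and Qg: "((\<lambda>i. Q (?dg i)) \<longlongrightarrow> 0) F"
    using f g by (simp_all add: tendsto_L2_def Q_def)
  \<comment> \<open>Multiplication on \<open>ennreal\<close> is discontinuous at infinity times 0,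
    so the mixed terms tend to 0 only because these norms are finite.\<close>
  have fin: "Q f0 \<noteq> \<infinity>" "Q g0 \<noteq> \<infinity>"
    using square_integrable_nn_finite[OF f0] square_integrable_nn_finite[OF g0] by (auto simp: Q_def)
  have "((\<lambda>i. N (?df i) (?dg i)) \<longlongrightarrow> 0) F"
    by (rule ennreal_tendsto_0_square_bound[OF CS])
       (use tendsto_mult_ennreal[OF Qf Qg] in simp_all)
  moreover have "((\<lambda>i. N f0 (?dg i)) \<longlongrightarrow> 0) F"
    by (rule ennreal_tendsto_0_square_bound[OF CS])
       (use fin in \<open>auto intro!: tendsto_eq_intros tendsto_mult_ennreal[OF tendsto_const Qg, THEN tendsto_eq_rhs]\<close>)
  moreover have "((\<lambda>i. N (?df i) g0) \<longlongrightarrow> 0) F"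
    by (rule ennreal_tendsto_0_square_bound[OF CS])
       (use fin in \<open>auto intro!: tendsto_mult_ennreal[OF Qf tendsto_const, THEN tendsto_eq_rhs]\<close>)
  ultimately have S: "((\<lambda>i. N (?df i) (?dg i) + N f0 (?dg i) + N (?df i) g0) \<longlongrightarrow> 0) F" (is "(?S \<longlongrightarrow> 0) F")
    using tendsto_add[OF tendsto_add] by fastforce
  have i0: "integrable M (\<lambda>x. f0 x * g0 x)" using f0 g0 by (rule square_integrable_mult)
  \<comment> \<open>Finiteness of \<open>?S i\<close> supplies the integrability that allows the
    difference of two Bochner integrals to be written as one.\<close>
  have bd: "ennreal (norm ((\<integral>x. f i x * g i x \<partial>M) - (\<integral>x. f0 x * g0 x \<partial>M))) \<le> ?S i" if "?S i < \<infinity>" for i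
  proof -
    let ?d = "\<lambda>x. f i x * g i x - f0 x * g0 x"
    have pt: "norm (?d x) \<le> norm (?df i x) * norm (?dg i x) + norm (f0 x) * norm (?dg i x) + norm (?df i x) * norm (g0 x)" for x
    proof -
      have "?d x = ?df i x * ?dg i x + f0 x * ?dg i x + ?df i x * g0 x" by (simp add: algebra_simps)
      then show ?thesis
        by (metis norm_triangle_le add_mono norm_mult_ineq)
    qed
    have "(\<integral>\<^sup>+x. ennreal (norm (?d x)) \<partial>M) \<le> (\<integral>\<^sup>+x. ennreal (norm (?df i x)) * ennreal (norm (?dg i x))
       + ennreal (norm (f0 x)) * ennreal (norm (?dg i x)) + ennreal (norm (?df i x)) * ennreal (norm (g0 x)) \<partial>M)"
      using pt by (intro nn_integral_mono) (simp flip: ennreal_mult ennreal_plus)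
    also have "\<dots> = ?S i" by (simp add: N_def nn_integral_add)
    finally have le: "(\<integral>\<^sup>+x. ennreal (norm (?d x)) \<partial>M) \<le> ?S i" .
    have id: "integrable M ?d"
      by (rule integrableI_bounded) (use le_less_trans[OF le that] in simp_all)
    have "integrable M (\<lambda>x. ?d x + f0 x * g0 x)" using id i0 by (rule Bochner_Integration.integrable_add)
    then have ifg: "integrable M (\<lambda>x. f i x * g i x)" by simp
    have "(\<integral>x. f i x * g i x \<partial>M) - (\<integral>x. f0 x * g0 x \<partial>M) = (\<integral>x. ?d x \<partial>M)"
      using ifg i0 by simp
    then show ?thesis using integral_norm_bound_ennreal[OF id] le by simp
  qed
  have "((\<lambda>i. ennreal (norm ((\<integral>x. f i x * g i x \<partial>M) - (\<integral>x. f0 x * g0 x \<partial>M)))) \<longlongrightarrow> 0) F"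
  proof (rule tendsto_sandwich[OF _ _ tendsto_const S])
    have "\<forall>\<^sub>F i in F. ?S i < \<infinity>" by (rule order_tendstoD(2)[OF S]) simp
    then show "\<forall>\<^sub>F i in F. ennreal (norm ((\<integral>x. f i x * g i x \<partial>M) - (\<integral>x. f0 x * g0 x \<partial>M))) \<le> ?S i"
      by eventually_elim (rule bd)
  qed auto
  then have "((\<lambda>i. norm ((\<integral>x. f i x * g i x \<partial>M) - (\<integral>x. f0 x * g0 x \<partial>M))) \<longlongrightarrow> 0) F"
    using tendsto_ennreal_iff[of "\<lambda>i. norm ((\<integral>x. f i x * g i x \<partial>M) - (\<integral>x. f0 x * g0 x \<partial>M))" F 0] by simp
  then show ?thesis by (simp add: tendsto_norm_zero_iff LIM_zero_iff)
qed

lemma tendsto_L2_const: "tendsto_L2 M (\<lambda>i. f) f F"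
  by (simp add: tendsto_L2_def)

text \<open>Pairing with \<open>V\<close> is linear and L2-continuous, so it passes through the
  Riemann sums and their limit. The limit is taken along \<open>division_filter\<close>, the filter
  that also defines \<open>has_integral\<close>, hence a gauge integral results.\<close>

lemma has_qm_integral_on_inner:
  fixes f :: "real \<Rightarrow> real" and X :: "real \<Rightarrow> 'a \<Rightarrow> real"
  assumes I: "has_qm_integral_on P (\<lambda>t x. X t x * f t) Y a b"
    and X: "\<And>t. square_integrable P (X t)" and V: "square_integrable P V"
  shows "((\<lambda>t. f t * (\<integral>x. X t x * V x \<partial>P)) has_integral (\<integral>x. Y x * V x \<partial>P)) {a..b}"
proof -
  let ?S = "\<lambda>D x. \<Sum>(t, K)\<in>D. measure lborel K * (X t x * f t)"
  have [measurable]: "X t \<in> borel_measurable P" for t using X by (auto simp: square_integrable_def)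
  have Y: "square_integrable P Y" and lim: "tendsto_L2 P ?S Y (division_filter (cbox a b))"
    using I by (auto simp: has_qm_integral_on_def)
  have L: "((\<lambda>D. \<integral>x. ?S D x * V x \<partial>P) \<longlongrightarrow> (\<integral>x. Y x * V x \<partial>P)) (division_filter (cbox a b))"
    using V by (intro tendsto_L2_integral_mult lim tendsto_L2_const Y)
      (auto simp: square_integrable_def split_beta')
  have eq: "(\<integral>x. ?S D x * V x \<partial>P) = (\<Sum>(t, K)\<in>D. measure lborel K *\<^sub>R (f t * (\<integral>x. X t x * V x \<partial>P)))" for D
  proof -
    have "(\<integral>x. ?S D x * V x \<partial>P) = (\<integral>x. (\<Sum>p\<in>D. (measure lborel (snd p) * f (fst p)) * (X (fst p) x * V x)) \<partial>P)"
      by (intro Bochner_Integration.integral_cong) (auto simp: sum_distrib_right split_beta' mult.assoc mult.left_commute intro!: sum.cong)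
    also have "\<dots> = (\<Sum>p\<in>D. (\<integral>x. (measure lborel (snd p) * f (fst p)) * (X (fst p) x * V x) \<partial>P))"
      by (intro Bochner_Integration.integral_sum integrable_mult_right square_integrable_mult X V)
    also have "\<dots> = (\<Sum>p\<in>D. (measure lborel (snd p) * f (fst p)) * (\<integral>x. X (fst p) x * V x \<partial>P))"
      by simp
    finally show ?thesis by (simp add: split_beta' mult.assoc)
  qed
  show ?thesis
    unfolding box_real[symmetric] has_integral_cbox using L[unfolded eq] .
qed

section \<open>Fubini for the Fourier kernel and Gaussian integrals\<close>

text \<open>A countable cover for \<open>lborel\<close> still works, since completion keeps the
  measure of its sets. Packets and spectrum are only Lebesgue measurable, so Fubini is needed over
  \<open>lebesgue\<close> itself.\<close>

lemma sigma_finite_lebesgue: "sigma_finite_measure (lebesgue :: 'a::euclidean_space measure)"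
proof
  obtain A :: "'a set set" where A: "countable A" "A \<subseteq> sets lborel" "\<Union>A = space lborel" "\<forall>a\<in>A. emeasure lborel a \<noteq> \<infinity>"
    using lborel.sigma_finite_countable by blast
  have "A \<subseteq> sets lebesgue" using A(2) by auto
  moreover have "\<forall>a\<in>A. emeasure lebesgue a \<noteq> \<infinity>" using A(2,4) by (auto simp: subset_eq)
  ultimately show "\<exists>A::'a set set. countable A \<and> A \<subseteq> sets lebesgue \<and> \<Union>A = space lebesgue \<and> (\<forall>a\<in>A. emeasure lebesgue a \<noteq> \<infinity>)"
    using A by (intro exI[of _ A]) auto
qed

interpretation lebesgue_pair: pair_sigma_finite "lebesgue :: real measure" "lebesgue :: real measure"
  by (intro pair_sigma_finite.intro sigma_finite_lebesgue)

lemma borel_imp_lebesgue_measurable: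
  "f \<in> borel_measurable borel \<Longrightarrow> f \<in> borel_measurable lebesgue"
  by (rule measurable_completion) simp

lemma measurable_ident_lebesgue: "(\<lambda>x::real. x) \<in> lebesgue \<rightarrow>\<^sub>M borel"
  by (rule borel_imp_lebesgue_measurable) simp

lemma cis_measurable [measurable]: "cis \<in> borel_measurable borel"
  by (intro borel_measurable_continuous_onI continuous_at_imp_continuous_on)
    (auto intro!: continuous_intros simp: cis_conv_exp[abs_def])

lemma integrable_mult_bounded:
  fixes f g :: "'a \<Rightarrow> complex"
  assumes f: "integrable M f" and [measurable]: "g \<in> borel_measurable M" and b: "\<And>x. norm (g x) \<le> C"
  shows "integrable M (\<lambda>x. f x * g x)"
proof (rule Bochner_Integration.integrable_bound)
  show "integrable M (\<lambda>x. C * norm (f x))" using f by simp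
  show "(\<lambda>x. f x * g x) \<in> borel_measurable M" using f by measurable
  have "norm (f x * g x) \<le> norm (C * norm (f x))" for x
    using mult_left_mono[OF b[of x] norm_ge_zero[of "f x"]] by (simp add: norm_mult mult.commute)
  then show "AE x in M. norm (f x * g x) \<le> norm (C * norm (f x))" by simp
qed

text \<open>The kernel has modulus 1, so \<open>h x * q t\<close> dominates. Both signs occur:
  \<open>c\<close> is -1 for the transform and 1 for its conjugate. The integrability part later
  allows a gauge integral in t to be read as a Lebesgue integral.\<close>

lemma Fubini_cis:
  fixes h q :: "real \<Rightarrow> complex" and c :: real
  assumes h: "integrable lebesgue h" and q: "integrable lebesgue q"
  shows Fubini_cis_integrable: "integrable lebesgue (\<lambda>t. q t * (\<integral>x. h x * cis (c * (x * t)) \<partial>lebesgue))" (is ?A)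
    and Fubini_cis_integral: "(\<integral>x. h x * (\<integral>t. q t * cis (c * (x * t)) \<partial>lebesgue) \<partial>lebesgue) =
      (\<integral>t. q t * (\<integral>x. h x * cis (c * (x * t)) \<partial>lebesgue) \<partial>lebesgue)" (is ?B)
proof -
  have [measurable]: "h \<in> borel_measurable lebesgue" "q \<in> borel_measurable lebesgue" using h q by auto
  note measurable_ident_lebesgue[measurable]
  have hq: "integrable (lebesgue \<Otimes>\<^sub>M lebesgue) (\<lambda>(x, t). h x * q t)"
    by (rule lebesgue_pair.Fubini_integrable) (use h q in \<open>auto simp: norm_mult\<close>)
  have f: "integrable (lebesgue \<Otimes>\<^sub>M lebesgue) (\<lambda>(x, t). h x * q t * cis (c * (x * t)))"
    using integrable_mult_bounded[OF hq, of "\<lambda>(x, t). cis (c * (x * t))" 1]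
    by (simp add: split_beta')
  have eq: "(\<integral>x. h x * q t * cis (c * (x * t)) \<partial>lebesgue) = q t * (\<integral>x. h x * cis (c * (x * t)) \<partial>lebesgue)" for t
    by (simp add: mult_ac flip: integral_mult_right_zero)
  have eq': "(\<integral>t. h x * q t * cis (c * (x * t)) \<partial>lebesgue) = h x * (\<integral>t. q t * cis (c * (x * t)) \<partial>lebesgue)" for x
    by (simp add: mult_ac flip: integral_mult_right_zero)
  show ?A using lebesgue_pair.integrable_snd[OF f] by (simp add: eq)
  show ?B using lebesgue_pair.Fubini_integral[OF f] by (simp add: eq eq')
qed

lemma cis_integral_measurable:
  fixes q :: "real \<Rightarrow> complex"
  assumes [measurable]: "q \<in> borel_measurable lebesgue"
  shows "(\<lambda>x. \<integral>t. q t * cis (c * (x * t)) \<partial>lebesgue) \<in> borel_measurable lebesgue"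
proof -
  interpret sigma_finite_measure "lebesgue :: real measure" by (rule sigma_finite_lebesgue)
  note measurable_ident_lebesgue[measurable]
  show ?thesis by measurable
qed

section \<open>Gaussian Fourier integrals\<close>

lemma std_normal_density_minus: "std_normal_density (- x) = std_normal_density x"
  by (simp add: std_normal_density_def)

text \<open>This is the characteristic function exp (- t^2 / 2) of the standard normal law,
  expressed through the density so that rescaling produces an approximate identity.\<close>

lemma integral_std_normal_density_cis:
  "integrable lebesgue (\<lambda>x. complex_of_real (std_normal_density x) * cis (x * t))"
  "(\<integral>x. complex_of_real (std_normal_density x) * cis (x * t) \<partial>lebesgue)
     = complex_of_real (sqrt (2 * pi) * std_normal_density t)"
proof -
  have m[measurable]: "(\<lambda>x. complex_of_real (std_normal_density x) * cis (x * t)) \<in> borel_measurable lborel"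
    by measurable
  have i: "integrable lborel (\<lambda>x. complex_of_real (std_normal_density x))"
    by (intro integrable_of_real integrable_normal_density) auto
  have "integrable lborel (\<lambda>x. complex_of_real (std_normal_density x) * cis (x * t))"
    using i by (rule integrable_mult_bounded[where C=1]) auto
  then show "integrable lebesgue (\<lambda>x. complex_of_real (std_normal_density x) * cis (x * t))"
    using m by (simp add: integrable_completion)
  have "(\<integral>x. complex_of_real (std_normal_density x) * cis (x * t) \<partial>lebesgue)
     = (\<integral>x. complex_of_real (std_normal_density x) * cis (x * t) \<partial>lborel)"
    using m by (simp add: integral_completion)
  also have "\<dots> = char std_normal_distribution t"
    unfolding char_def
    by (subst integral_density) (auto simp: scaleR_conv_of_real cis_conv_exp mult_ac)
  also have "\<dots> = complex_of_real (exp (- (t^2) / 2))" by (simp add: char_std_normal_distribution)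
  also have "\<dots> = complex_of_real (sqrt (2 * pi) * std_normal_density t)"
    by (simp add: std_normal_density_def)
  finally show "(\<integral>x. complex_of_real (std_normal_density x) * cis (x * t) \<partial>lebesgue)
     = complex_of_real (sqrt (2 * pi) * std_normal_density t)" .
qed

text \<open>Width n in frequency becomes width 1 / n in time:
  \<open>n * std_normal_density (n * t)\<close> has mass 1 and concentrates at 0 as n grows.\<close>

lemma integral_scaled_normal_density_cis:
  assumes "n > 0"
  shows "(\<integral>x. complex_of_real (std_normal_density (x / n)) * cis (x * t) \<partial>lebesgue)
     = complex_of_real (sqrt (2 * pi) * n * std_normal_density (n * t))"
proof -
  have "(\<integral>x. complex_of_real (std_normal_density (x / n)) * cis (x * t) \<partial>lebesgue)
    = n *\<^sub>R (\<integral>x. complex_of_real (std_normal_density x) * cis (x * (n * t)) \<partial>lebesgue)"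
    using assms by (subst lebesgue_integral_real_affine[where c=n and t=0]) (auto simp: mult_ac)
  also have "\<dots> = complex_of_real (sqrt (2 * pi) * n * std_normal_density (n * t))"
    by (simp add: integral_std_normal_density_cis scaleR_conv_of_real)
  finally show ?thesis .
qed

lemma std_normal_density_le_1: "std_normal_density x \<le> 1"
proof -
  have "1 \<le> sqrt (2 * pi)" using pi_ge_two by simp
  moreover have "exp (- x\<^sup>2 / 2) \<le> 1" by simp
  ultimately show ?thesis unfolding std_normal_density_def
    by (metis (no_types, lifting) divide_le_eq_1 divide_self_if exp_ge_zero less_eq_real_def
      mult_le_one order_trans real_sqrt_ge_0_iff times_divide_eq_left mult_1 zero_le_divide_1_iff not_one_le_zero)
qed

text \<open>A test function must be in L2 to be paired with a transform that is an L2 limit, and in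
  L1 for Fubini.\<close>

lemma square_integrable_scaled_normal_cis:
  assumes "n > 0"
  shows "square_integrable lebesgue (\<lambda>x. cis (x * s) * complex_of_real (std_normal_density (x / n)))"
    and "integrable lebesgue (\<lambda>x. cis (x * s) * complex_of_real (std_normal_density (x / n)))"
proof -
  have [measurable]: "(\<lambda>x. std_normal_density (x / n)) \<in> borel_measurable lebesgue"
    by (rule borel_imp_lebesgue_measurable) measurable
  have i: "integrable lebesgue (\<lambda>x. std_normal_density (x / n))"
  proof -
    have "integrable lborel std_normal_density" by (intro integrable_normal_density) auto
    then have "integrable lborel (\<lambda>x. std_normal_density (0 + (1 / n) * x))"
      by (rule lborel_integrable_real_affine) (use assms in auto)
    then show ?thesis by (simp add: integrable_completion)
  qed
  note measurable_ident_lebesgue[measurable]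
  show "integrable lebesgue (\<lambda>x. cis (x * s) * complex_of_real (std_normal_density (x / n)))"
    using integrable_mult_bounded[OF integrable_of_real[OF i], of "\<lambda>x. cis (x * s)" 1] by (simp add: mult.commute)
  have "integrable lebesgue (\<lambda>x. (std_normal_density (x / n))\<^sup>2)"
  proof (rule Bochner_Integration.integrable_bound[OF i])
    show "AE x in lebesgue. norm ((std_normal_density (x / n))\<^sup>2) \<le> norm (std_normal_density (x / n))"
      by (auto simp: power2_eq_square mult_left_le std_normal_density_le_1 intro!: AE_I2)
  qed measurable
  then show "square_integrable lebesgue (\<lambda>x. cis (x * s) * complex_of_real (std_normal_density (x / n)))"
    by (simp add: square_integrable_def norm_mult)
qed

section \<open>Truncated Fourier transforms and inversion\<close>

definition truncated_fourier :: "real \<Rightarrow> (real \<Rightarrow> complex) \<Rightarrow> real \<Rightarrow> complex" where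
  "truncated_fourier T f \<omega> = (LINT t:{-T..T}|lebesgue. f t * exp (- (\<i> * complex_of_real (\<omega> * t))))"

text \<open>Moves the window into the integrand and gives the exponential the shape of
  \<open>Fubini_cis\<close> with \<open>c\<close> equal to -1.\<close>

lemma truncated_fourier_eq:
  "truncated_fourier T f \<omega> = (\<integral>t. (indicator {-T..T} t * f t) * cis (-1 * (\<omega> * t)) \<partial>lebesgue)"
  unfolding truncated_fourier_def set_lebesgue_integral_def
  by (intro Bochner_Integration.integral_cong) (auto simp: cis_conv_exp scaleR_conv_of_real split: split_indicator)

lemma indicator_interval_times_measurable [measurable]:
  fixes f :: "real \<Rightarrow> complex"
  assumes [measurable]: "f \<in> borel_measurable lebesgue"
  shows "(\<lambda>t. indicator {a..b} t * f t) \<in> borel_measurable lebesgue"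
  by (intro borel_measurable_times assms borel_measurable_indicator) auto

lemma truncated_fourier_measurable [measurable]:
  assumes "f \<in> borel_measurable lebesgue"
  shows "truncated_fourier T f \<in> borel_measurable lebesgue"
  unfolding truncated_fourier_eq[abs_def]
  by (intro cis_integral_measurable indicator_interval_times_measurable assms)

lemma integrable_indicator_interval:
  "integrable lebesgue (\<lambda>t::real. (indicator {a..b} t :: real))"
  by (rule integrable_real_indicator) (auto simp: emeasure_lborel_Icc_eq)

text \<open>Since \<open>g\<close> is known only as an L2 limit, it is tested against exponentials
  damped by a Gaussian of width n. Fubini turns the pairing into a Gaussian mean of \<open>R\<close>
  around s of width 1 / n. As n grows, one side tends to a multiple of the inverse transform,
  dominated by \<open>g\<close>, and the other to a multiple of \<open>R s\<close>, by continuity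
  and boundedness of \<open>R\<close>.\<close>

lemma Fourier_inversion:
  fixes R g :: "real \<Rightarrow> complex"
  assumes R: "continuous_on UNIV R" "\<And>t. norm (R t) \<le> C"
    and ft: "has_fourier_transform R g" and g: "integrable lebesgue g"
  shows "R s = 1 / (2 * pi) * (\<integral>\<omega>. g \<omega> * cis (\<omega> * s) \<partial>lebesgue)"
proof -
  have Rm[measurable]: "R \<in> borel_measurable borel" using R(1) by (rule borel_measurable_continuous_onI)
  have Rl[measurable]: "R \<in> borel_measurable lebesgue" by (rule borel_imp_lebesgue_measurable[OF Rm])
  have gm[measurable]: "g \<in> borel_measurable lebesgue" using g by simp
  define d where "d n x = complex_of_real (std_normal_density (x / n))" for n x :: real
  define \<phi> where "\<phi> n x = cis (x * s) * d n x" for n x :: real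
  have dn: "norm (d n x) \<le> 1" for n x
    using std_normal_density_le_1[of "x / n"] by (simp add: d_def)
  have dm[measurable]: "d n \<in> borel_measurable borel" for n unfolding d_def by measurable
  have sqg: "square_integrable lebesgue g"
    and lim: "tendsto_L2 lebesgue (\<lambda>T. truncated_fourier T R) g at_top"
    using ft by (simp_all add: has_fourier_transform_def truncated_fourier_def[abs_def])
  have cint: "integrable lborel (\<lambda>x. complex_of_real (std_normal_density x))"
    by (intro integrable_of_real integrable_normal_density) auto
  \<comment> \<open>A Parseval relation: it is proved for the truncated transform in place of
    \<open>g\<close>, and then T tends to infinity on both sides.\<close>
  have key: "(\<integral>\<omega>. g \<omega> * \<phi> n \<omega> \<partial>lebesgue)
      = sqrt (2 * pi) * (\<integral>x. complex_of_real (std_normal_density x) * R (s + x / n) \<partial>lborel)" if n: "n > 0" for n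
  proof -
    have sq\<phi>: "square_integrable lebesgue (\<phi> n)" and i\<phi>: "integrable lebesgue (\<phi> n)"
      using square_integrable_scaled_normal_cis[OF n] by (simp_all add: \<phi>_def[abs_def] d_def)
    define k where "k t = complex_of_real (n * std_normal_density (n * (s - t)))" for t
    have km[measurable]: "k \<in> borel_measurable borel" unfolding k_def by measurable
    \<comment> \<open>Substitution t = s + x / n; its Jacobian 1 / n absorbs the factor n in
      \<open>k\<close>.\<close>
    have aff: "(\<integral>t. R t * k t \<partial>lborel) = (\<integral>x. complex_of_real (std_normal_density x) * R (s + x / n) \<partial>lborel)"
      using n by (subst lborel_integral_real_affine[where c="1 / n" and t=s])
        (auto simp: k_def std_normal_density_minus field_simps scaleR_conv_of_real)
    have ki: "integrable lborel k"
    proof -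
      have "integrable lborel (\<lambda>x. complex_of_real (std_normal_density (n * s + (- n) * x)))"
        by (rule lborel_integrable_real_affine[OF cint]) (use n in auto)
      then have "integrable lborel (\<lambda>x. complex_of_real n * complex_of_real (std_normal_density (n * s + (- n) * x)))"
        by (rule integrable_mult_right)
      then show ?thesis by (simp add: k_def[abs_def] algebra_simps)
    qed
    have kR: "integrable lborel (\<lambda>t. R t * k t)"
      using integrable_mult_bounded[OF ki, of R C] R(2) by (simp add: mult.commute)
    have 1: "((\<lambda>T. \<integral>\<omega>. truncated_fourier T R \<omega> * \<phi> n \<omega> \<partial>lebesgue) \<longlongrightarrow> (\<integral>\<omega>. g \<omega> * \<phi> n \<omega> \<partial>lebesgue)) at_top"
      by (intro tendsto_L2_integral_mult lim tendsto_L2_const sqg sq\<phi> truncated_fourier_measurable Rl)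
        (use i\<phi> in auto)
    have 2: "(\<integral>\<omega>. truncated_fourier T R \<omega> * \<phi> n \<omega> \<partial>lebesgue)
        = sqrt (2 * pi) * (\<integral>t. indicator {-T..T} t *\<^sub>R (R t * k t) \<partial>lborel)" for T
    proof -
      have q: "integrable lebesgue (\<lambda>t. indicator {-T..T} t * R t)"
        using integrable_mult_bounded[OF integrable_of_real[OF integrable_indicator_interval], of R C "-T" T] R(2)
        by (simp add: of_real_indicator)
      have inner: "(\<integral>\<omega>. \<phi> n \<omega> * cis (-1 * (\<omega> * t)) \<partial>lebesgue) = sqrt (2 * pi) * k t" for t
      proof -
        have "(\<integral>\<omega>. \<phi> n \<omega> * cis (-1 * (\<omega> * t)) \<partial>lebesgue) = (\<integral>\<omega>. complex_of_real (std_normal_density (\<omega> / n)) * cis (\<omega> * (s - t)) \<partial>lebesgue)"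
        proof (intro Bochner_Integration.integral_cong refl)
          fix \<omega> :: real
          have "cis (\<omega> * s) * cis (-1 * (\<omega> * t)) = cis (\<omega> * (s - t))"
            by (simp add: cis_mult right_diff_distrib)
          then show "\<phi> n \<omega> * cis (-1 * (\<omega> * t)) = complex_of_real (std_normal_density (\<omega> / n)) * cis (\<omega> * (s - t))"
            by (simp add: \<phi>_def d_def mult_ac)
        qed
        then show ?thesis by (simp add: integral_scaled_normal_density_cis[OF n] k_def)
      qed
      have "(\<integral>\<omega>. truncated_fourier T R \<omega> * \<phi> n \<omega> \<partial>lebesgue)
          = (\<integral>\<omega>. \<phi> n \<omega> * (\<integral>t. (indicator {-T..T} t * R t) * cis (-1 * (\<omega> * t)) \<partial>lebesgue) \<partial>lebesgue)"
        by (simp add: truncated_fourier_eq mult.commute)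
      also have "\<dots> = (\<integral>t. (indicator {-T..T} t * R t) * (\<integral>\<omega>. \<phi> n \<omega> * cis (-1 * (\<omega> * t)) \<partial>lebesgue) \<partial>lebesgue)"
        by (rule Fubini_cis_integral[OF i\<phi> q])
      also have "\<dots> = (\<integral>t. (indicator {-T..T} t * R t) * (sqrt (2 * pi) * k t) \<partial>lebesgue)"
        by (simp only: inner)
      also have "\<dots> = (\<integral>t. (indicator {-T..T} t * R t) * (sqrt (2 * pi) * k t) \<partial>lborel)"
        by (rule integral_completion) measurable
      also have "\<dots> = (\<integral>t. sqrt (2 * pi) * (indicator {-T..T} t *\<^sub>R (R t * k t)) \<partial>lborel)"
        by (intro Bochner_Integration.integral_cong) (auto split: split_indicator)
      also have "\<dots> = sqrt (2 * pi) * (\<integral>t. indicator {-T..T} t *\<^sub>R (R t * k t) \<partial>lborel)"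
        by (rule integral_mult_right_zero)
      finally show ?thesis .
    qed
    have 3: "((\<lambda>T. \<integral>t. indicator {-T..T} t *\<^sub>R (R t * k t) \<partial>lborel) \<longlongrightarrow> (\<integral>t. R t * k t \<partial>lborel)) at_top"
    proof (rule integral_dominated_convergence_at_top[where w="\<lambda>t. norm (R t * k t)"])
      show "AE x in lborel. ((\<lambda>T. indicat_real {- T..T} x *\<^sub>R (R x * k x)) \<longlongrightarrow> R x * k x) at_top"
      proof (intro AE_I2 tendsto_eventually)
        fix x :: real
        show "\<forall>\<^sub>F T in at_top. indicat_real {- T..T} x *\<^sub>R (R x * k x) = R x * k x"
          using eventually_ge_at_top[of "\<bar>x\<bar>"] by eventually_elim (auto simp: indicator_def)
      qed
    qed (use kR in \<open>auto split: split_indicator\<close>)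
    have "((\<lambda>T. \<integral>\<omega>. truncated_fourier T R \<omega> * \<phi> n \<omega> \<partial>lebesgue) \<longlongrightarrow> sqrt (2 * pi) * (\<integral>t. R t * k t \<partial>lborel)) at_top"
      unfolding 2 by (intro tendsto_mult tendsto_const 3)
    with 1 show ?thesis unfolding aff by (rule tendsto_unique[rotated]) simp
  qed
  \<comment> \<open>For every x, \<open>d n x\<close> tends to \<open>d 1 0\<close>, the peak of the
    Gaussian; the index \<open>Suc i\<close> keeps the width positive.\<close>
  have L: "(\<lambda>i. \<integral>\<omega>. g \<omega> * \<phi> (Suc i) \<omega> \<partial>lebesgue) \<longlonglongrightarrow> (\<integral>\<omega>. g \<omega> * (cis (\<omega> * s) * d 1 0) \<partial>lebesgue)"
  proof (rule integral_dominated_convergence[where w="\<lambda>\<omega>. norm (g \<omega>)"])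
    note measurable_ident_lebesgue[measurable]
    show "(\<lambda>\<omega>. g \<omega> * (cis (\<omega> * s) * d 1 0)) \<in> borel_measurable lebesgue" by measurable
    show "(\<lambda>\<omega>. g \<omega> * \<phi> (Suc i) \<omega>) \<in> borel_measurable lebesgue" for i unfolding \<phi>_def by measurable
    show "AE x in lebesgue. (\<lambda>i. g x * \<phi> (real (Suc i)) x) \<longlonglongrightarrow> g x * (cis (x * s) * d 1 0)"
    proof (intro AE_I2 tendsto_mult tendsto_const)
      fix x :: real
      have "(\<lambda>i. x * inverse (real (Suc i))) \<longlonglongrightarrow> x * 0"
        by (intro tendsto_mult tendsto_const LIMSEQ_inverse_real_of_nat)
      then have "(\<lambda>i. x / real (Suc i)) \<longlonglongrightarrow> 0" by (simp add: divide_inverse)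
      moreover have "isCont (d 1) 0"
        unfolding d_def std_normal_density_def by (intro continuous_intros) auto
      ultimately have "(\<lambda>i. d 1 (x / real (Suc i))) \<longlonglongrightarrow> d 1 0"
        using isCont_tendsto_compose by blast
      then show "(\<lambda>i. \<phi> (real (Suc i)) x) \<longlonglongrightarrow> cis (x * s) * d 1 0"
        unfolding \<phi>_def by (intro tendsto_mult tendsto_const) (simp add: d_def)
    qed
    show "AE x in lebesgue. norm (g x * \<phi> (real (Suc i)) x) \<le> norm (g x)" for i
      using dn by (auto simp: \<phi>_def norm_mult mult_left_le)
  qed (use g in simp)
  have R': "(\<lambda>i. \<integral>x. complex_of_real (std_normal_density x) * R (s + x / Suc i) \<partial>lborel)
     \<longlonglongrightarrow> (\<integral>x. complex_of_real (std_normal_density x) * R s \<partial>lborel)"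
  proof (rule integral_dominated_convergence[where w="\<lambda>x. C * std_normal_density x"])
    show "AE x in lborel. (\<lambda>i. complex_of_real (std_normal_density x) * R (s + x / real (Suc i)))
        \<longlonglongrightarrow> complex_of_real (std_normal_density x) * R s"
    proof (intro AE_I2 tendsto_mult tendsto_const)
      fix x :: real
      have "(\<lambda>i. s + x * inverse (real (Suc i))) \<longlonglongrightarrow> s + x * 0"
        by (intro tendsto_add tendsto_mult tendsto_const LIMSEQ_inverse_real_of_nat)
      then have "(\<lambda>i. s + x / real (Suc i)) \<longlonglongrightarrow> s" by (simp add: divide_inverse)
      moreover have "isCont R s" using R(1) by (simp add: continuous_on_eq_continuous_at)
      ultimately show "(\<lambda>i. R (s + x / real (Suc i))) \<longlonglongrightarrow> R s" using isCont_tendsto_compose by blast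
    qed
    show "AE x in lborel. norm (complex_of_real (std_normal_density x) * R (s + x / real (Suc i))) \<le> C * std_normal_density x" for i
      using mult_right_mono[OF R(2)] by (auto simp: norm_mult mult.commute[of "std_normal_density _"] intro!: AE_I2)
  qed (auto intro!: integrable_mult_right integrable_normal_density)
  have "(\<integral>x. complex_of_real (std_normal_density x) * R s \<partial>lborel) = R s"
    using integral_normal_density[of 1 0] by simp
  with R' have "(\<lambda>i. sqrt (2 * pi) * (\<integral>x. complex_of_real (std_normal_density x) * R (s + x / Suc i) \<partial>lborel)) \<longlonglongrightarrow> sqrt (2 * pi) * R s"
    by (intro tendsto_mult tendsto_const) simp
  then have "(\<lambda>i. \<integral>\<omega>. g \<omega> * \<phi> (Suc i) \<omega> \<partial>lebesgue) \<longlonglongrightarrow> sqrt (2 * pi) * R s"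
    by (simp add: key)
  with L have "(\<integral>\<omega>. g \<omega> * (cis (\<omega> * s) * d 1 0) \<partial>lebesgue) = sqrt (2 * pi) * R s"
    using LIMSEQ_unique by blast
  moreover have "(\<integral>\<omega>. g \<omega> * (cis (\<omega> * s) * d 1 0) \<partial>lebesgue) = (\<integral>\<omega>. g \<omega> * cis (\<omega> * s) \<partial>lebesgue) * d 1 0"
    by (simp flip: mult.assoc)
  \<comment> \<open>The peak value 1 / sqrt (2 pi) on one side and the factor sqrt (2 pi) of the
    Gaussian transform on the other combine to the constant 1 / (2 pi).\<close>
  moreover have "d 1 0 = complex_of_real (1 / sqrt (2 * pi))" by (simp add: d_def std_normal_density_def)
  moreover have "complex_of_real (sqrt (2 * pi)) * complex_of_real (sqrt (2 * pi)) = 2 * pi"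
    by (simp flip: of_real_mult)
  ultimately show ?thesis by (simp add: field_simps)
qed

section \<open>The spectral formula for packet coefficients\<close>

text \<open>A gauge integral may exist without absolute integrability, which is therefore a
  hypothesis; uniqueness of the gauge integral then identifies the values.\<close>

lemma has_integral_eq_lebesgue:
  fixes F :: "real \<Rightarrow> complex"
  assumes i: "integrable lebesgue (\<lambda>t. indicator S t * F t)" and F: "(F has_integral y) S"
  shows "y = (\<integral>t. indicator S t * F t \<partial>lebesgue)"
proof -
  have "((\<lambda>t. if t \<in> S then F t else 0) has_integral y) UNIV"
    using F by (simp add: has_integral_restrict_UNIV)
  moreover have "(\<lambda>t. if t \<in> S then F t else 0) = (\<lambda>t. indicator S t * F t)" by auto
  ultimately show ?thesis using has_integral_integral_lebesgue[OF i] has_integral_unique by metis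
qed

text \<open>Pairing with the indicator shows that L2 functions are integrable on bounded intervals,
  so a truncated transform is a genuine integral.\<close>

lemma integrable_indicator_square_integrable:
  fixes f :: "real \<Rightarrow> complex"
  assumes f: "square_integrable lebesgue f"
  shows "integrable lebesgue (\<lambda>t. indicator {a..b} t * f t)"
proof -
  have "square_integrable lebesgue (\<lambda>t. indicator {a..b} t :: complex)"
  proof -
    have "(\<lambda>t. (norm (indicator {a..b} t :: complex))\<^sup>2) = (indicator {a..b} :: real \<Rightarrow> real)"
      by (auto split: split_indicator)
    then show ?thesis using integrable_indicator_interval[of a b]
      by (simp add: square_integrable_def borel_measurable_indicator)
  qed
  then show ?thesis using f by (rule square_integrable_mult)
qed

text \<open>The bound is free of \<omega>; for fixed T, an integrable spectrum times a truncated
  transform is therefore integrable.\<close>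

lemma norm_truncated_fourier_le:
  "norm (truncated_fourier T f \<omega>) \<le> (\<integral>t. norm (indicator {-T..T} t * f t) \<partial>lebesgue)"
proof -
  have "norm (truncated_fourier T f \<omega>) \<le> (\<integral>t. norm ((indicator {-T..T} t * f t) * cis (-1 * (\<omega> * t))) \<partial>lebesgue)"
    unfolding truncated_fourier_eq by (rule integral_norm_bound)
  then show ?thesis by (simp add: norm_mult)
qed

lemma cnj_truncated_fourier:
  "cnj (truncated_fourier T (\<lambda>t. of_real (f t)) \<omega>)
    = (\<integral>t. (indicator {-T..T} t * complex_of_real (f t)) * cis (1 * (\<omega> * t)) \<partial>lebesgue)"
  unfolding truncated_fourier_eq
  unfolding Bochner_Integration.integral_cnj[symmetric]
  by (intro Bochner_Integration.integral_cong) (auto simp: cis_cnj split: split_indicator)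

text \<open>The time integrals are removed one at a time: pairing J with \<open>X t\<close> writes
  E[X(t) J] as an inverse transform that carries the factor \<open>?G\<close>, and pairing I with J
  then produces the other factor. No double Riemann sum occurs.\<close>

lemma expectation_qm_integrals:
  fixes f g :: "real \<Rightarrow> real" and X :: "real \<Rightarrow> 'a \<Rightarrow> real" and \<gamma> :: "real \<Rightarrow> complex"
  assumes X: "\<And>t. square_integrable P (X t)"
    and \<gamma>: "integrable lebesgue \<gamma>"
    and R: "\<And>t s. complex_of_real (\<integral>x. X t x * X s x \<partial>P) = 1 / (2 * pi) * (\<integral>\<omega>. \<gamma> \<omega> * cis (\<omega> * (t - s)) \<partial>lebesgue)"
    and f: "square_integrable lebesgue (\<lambda>t. complex_of_real (f t))"
    and g: "square_integrable lebesgue (\<lambda>t. complex_of_real (g t))"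
    and I: "has_qm_integral_on P (\<lambda>t x. X t x * f t) I (-T) T"
    and J: "has_qm_integral_on P (\<lambda>t x. X t x * g t) J (-T) T"
  shows "complex_of_real (\<integral>x. I x * J x \<partial>P) = 1 / (2 * pi) * (\<integral>\<omega>. \<gamma> \<omega> * cnj (truncated_fourier T (\<lambda>t. of_real (f t)) \<omega>)
      * truncated_fourier T (\<lambda>t. of_real (g t)) \<omega> \<partial>lebesgue)"
proof -
  note measurable_ident_lebesgue[measurable]
  define qf where "qf t = indicator {-T..T} t * complex_of_real (f t)" for t
  define qg where "qg t = indicator {-T..T} t * complex_of_real (g t)" for t
  have qf: "integrable lebesgue qf" and qg: "integrable lebesgue qg"
    using integrable_indicator_square_integrable[OF f] integrable_indicator_square_integrable[OF g]
    by (simp_all add: qf_def[abs_def] qg_def[abs_def])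
  have gm: "(\<lambda>t. complex_of_real (g t)) \<in> borel_measurable lebesgue" using g by (simp add: square_integrable_def)
  have J2: "square_integrable P J" using J by (simp add: has_qm_integral_on_def)
  let ?G = "truncated_fourier T (\<lambda>t. of_real (g t))" and ?F = "truncated_fourier T (\<lambda>t. of_real (f t))"
  define c where "c = complex_of_real (1 / (2 * pi))"
  \<comment> \<open>Here \<open>V\<close> is \<open>X t\<close>. The spectral form of E[X(s) X(t)]
    leaves an integral of \<open>g\<close> against exp (- i \<omega> s) over the window, which is
    \<open>?G\<close>.\<close>
  have EJ: "complex_of_real (\<integral>x. X t x * J x \<partial>P) = c * (\<integral>\<omega>. (\<gamma> \<omega> * ?G \<omega>) * cis (1 * (\<omega> * t)) \<partial>lebesgue)" for t
  proof -
    let ?h = "\<lambda>\<omega>. c * (\<gamma> \<omega> * cis (\<omega> * t))"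
    have h: "integrable lebesgue ?h"
      by (intro integrable_mult_right integrable_mult_bounded[where C=1] \<gamma>) auto
    have eq: "complex_of_real (g s * (\<integral>x. X s x * X t x \<partial>P)) = of_real (g s) * (\<integral>\<omega>. ?h \<omega> * cis (-1 * (\<omega> * s)) \<partial>lebesgue)" for s
    proof -
      have 1: "?h \<omega> * cis (-1 * (\<omega> * s)) = c * (\<gamma> \<omega> * cis (\<omega> * (t - s)))" for \<omega>
      proof -
        have "cis (\<omega> * t) * cis (-1 * (\<omega> * s)) = cis (\<omega> * (t - s))"
          by (simp add: cis_mult right_diff_distrib)
        then show ?thesis by (simp add: mult_ac)
      qed
      have "complex_of_real (\<integral>x. X s x * X t x \<partial>P) = complex_of_real (\<integral>x. X t x * X s x \<partial>P)"
        by (simp add: mult.commute)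
      then show ?thesis unfolding 1 by (simp add: R c_def)
    qed
    have "((\<lambda>s. g s * (\<integral>x. X s x * X t x \<partial>P)) has_integral (\<integral>x. J x * X t x \<partial>P)) {-T..T}"
      by (rule has_qm_integral_on_inner[OF J X X])
    then have "((\<lambda>s. complex_of_real (g s * (\<integral>x. X s x * X t x \<partial>P))) has_integral complex_of_real (\<integral>x. J x * X t x \<partial>P)) {-T..T}"
      by (rule has_integral_of_real)
    then have hi: "((\<lambda>s. of_real (g s) * (\<integral>\<omega>. ?h \<omega> * cis (-1 * (\<omega> * s)) \<partial>lebesgue)) has_integral complex_of_real (\<integral>x. J x * X t x \<partial>P)) {-T..T}"
      unfolding eq .
    have "complex_of_real (\<integral>x. J x * X t x \<partial>P) = (\<integral>s. qg s * (\<integral>\<omega>. ?h \<omega> * cis (-1 * (\<omega> * s)) \<partial>lebesgue) \<partial>lebesgue)"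
      using has_integral_eq_lebesgue[OF _ hi] Fubini_cis_integrable[OF h qg, of "-1"]
      by (simp add: qg_def mult.assoc)
    also have "\<dots> = (\<integral>\<omega>. ?h \<omega> * (\<integral>s. qg s * cis (-1 * (\<omega> * s)) \<partial>lebesgue) \<partial>lebesgue)"
      by (rule Fubini_cis_integral[OF h qg, symmetric])
    also have "\<dots> = (\<integral>\<omega>. c * ((\<gamma> \<omega> * ?G \<omega>) * cis (1 * (\<omega> * t))) \<partial>lebesgue)"
      by (intro Bochner_Integration.integral_cong) (auto simp: truncated_fourier_eq qg_def)
    finally show ?thesis by (simp add: mult.commute)
  qed
  \<comment> \<open>Now \<open>V\<close> is \<open>J\<close>, and the weight is the spectrum times
    \<open>?G\<close>, integrable because \<open>?G\<close> is bounded over all frequencies.\<close>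
  let ?h = "\<lambda>\<omega>. c * (\<gamma> \<omega> * ?G \<omega>)"
  have h: "integrable lebesgue ?h"
    by (rule integrable_mult_right, rule integrable_mult_bounded[OF \<gamma> truncated_fourier_measurable[OF gm] norm_truncated_fourier_le])
  have eq: "complex_of_real (f t * (\<integral>x. X t x * J x \<partial>P)) = of_real (f t) * (\<integral>\<omega>. ?h \<omega> * cis (1 * (\<omega> * t)) \<partial>lebesgue)" for t
    by (simp add: EJ mult.assoc)
  have "((\<lambda>t. f t * (\<integral>x. X t x * J x \<partial>P)) has_integral (\<integral>x. I x * J x \<partial>P)) {-T..T}"
    by (rule has_qm_integral_on_inner[OF I X J2])
  then have "((\<lambda>t. complex_of_real (f t * (\<integral>x. X t x * J x \<partial>P))) has_integral complex_of_real (\<integral>x. I x * J x \<partial>P)) {-T..T}"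
    by (rule has_integral_of_real)
  then have hi: "((\<lambda>t. of_real (f t) * (\<integral>\<omega>. ?h \<omega> * cis (1 * (\<omega> * t)) \<partial>lebesgue)) has_integral complex_of_real (\<integral>x. I x * J x \<partial>P)) {-T..T}"
    unfolding eq .
  have "complex_of_real (\<integral>x. I x * J x \<partial>P) = (\<integral>t. qf t * (\<integral>\<omega>. ?h \<omega> * cis (1 * (\<omega> * t)) \<partial>lebesgue) \<partial>lebesgue)"
    using has_integral_eq_lebesgue[OF _ hi] Fubini_cis_integrable[OF h qf, of "1"]
    by (simp add: qf_def mult.assoc)
  also have "\<dots> = (\<integral>\<omega>. ?h \<omega> * (\<integral>t. qf t * cis (1 * (\<omega> * t)) \<partial>lebesgue) \<partial>lebesgue)"
    by (rule Fubini_cis_integral[OF h qf, symmetric])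
  also have "\<dots> = (\<integral>\<omega>. c * (\<gamma> \<omega> * cnj (?F \<omega>) * ?G \<omega>) \<partial>lebesgue)"
    by (intro Bochner_Integration.integral_cong) (auto simp: cnj_truncated_fourier qf_def)
  finally show ?thesis by (simp add: c_def)
qed

text \<open>The set is where the windows \<open>[-T, T]\<close> and \<open>[-T - a, T - a]\<close> may differ.\<close>

lemma window_shift_tendsto_0:
  fixes w :: "real \<Rightarrow> complex"
  assumes w: "square_integrable lebesgue w"
  shows "((\<lambda>T. \<integral>t. indicator ({-T-\<bar>a\<bar>..-T+\<bar>a\<bar>} \<union> {T-\<bar>a\<bar>..T+\<bar>a\<bar>}) t * norm (w t) \<partial>lebesgue) \<longlongrightarrow> 0) at_top"
proof -
  define E where "E T = {-T-\<bar>a\<bar>..-T+\<bar>a\<bar>} \<union> {T-\<bar>a\<bar>..T+\<bar>a\<bar>}" for T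
  have [measurable]: "w \<in> borel_measurable lebesgue" and w2: "integrable lebesgue (\<lambda>t. (norm (w t))\<^sup>2)"
    using w by (auto simp: square_integrable_def)
  have E[measurable]: "E T \<in> sets lebesgue" for T by (simp add: E_def)
  \<comment> \<open>Two intervals of length 2|a|, whatever T is.\<close>
  have em: "emeasure lebesgue (E T) \<le> ennreal (4 * \<bar>a\<bar>)" for T
  proof -
    have "emeasure lebesgue (E T) \<le> emeasure lebesgue {-T-\<bar>a\<bar>..-T+\<bar>a\<bar>} + emeasure lebesgue {T-\<bar>a\<bar>..T+\<bar>a\<bar>}"
      unfolding E_def by (rule emeasure_subadditive) auto
    also have "\<dots> = ennreal (4 * \<bar>a\<bar>)" by (simp flip: ennreal_plus)
    finally show ?thesis .
  qed
  have E2: "square_integrable lebesgue (\<lambda>t. indicator (E T) t :: real)" for T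
  proof -
    have "integrable lebesgue (\<lambda>t. indicator (E T) t :: real)"
      using em[of T] by (intro integrable_real_indicator) (auto intro: order_le_less_trans simp: ennreal_less_top)
    then show ?thesis by (simp add: square_integrable_def power2_eq_square flip: indicator_inter_arith)
  qed
  \<comment> \<open>A fixed point x lies outside \<open>E T\<close> once T exceeds |x| + |a|, and
    |w|^2 dominates.\<close>
  have Y: "((\<lambda>T. \<integral>t. indicator (E T) t *\<^sub>R (norm (w t))\<^sup>2 \<partial>lebesgue) \<longlongrightarrow> (\<integral>t. 0 \<partial>(lebesgue :: real measure))) at_top"
  proof (rule integral_dominated_convergence_at_top[where w="\<lambda>t. (norm (w t))\<^sup>2"])
    show "AE x in lebesgue. ((\<lambda>T. indicat_real (E T) x *\<^sub>R (norm (w x))\<^sup>2) \<longlongrightarrow> 0) at_top"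
    proof (intro AE_I2 tendsto_eventually)
      fix x :: real
      show "\<forall>\<^sub>F T in at_top. indicat_real (E T) x *\<^sub>R (norm (w x))\<^sup>2 = 0"
        using eventually_gt_at_top[of "\<bar>x\<bar> + \<bar>a\<bar>"] by eventually_elim (auto simp: indicator_def E_def)
    qed
    show "(\<lambda>t. indicat_real (E T) t *\<^sub>R (norm (w t))\<^sup>2) \<in> borel_measurable lebesgue" for T
      by measurable
  qed (use w2 in \<open>auto split: split_indicator\<close>)
  \<comment> \<open>Cauchy-Schwarz on a set of bounded measure turns the vanishing L2 tail of
    \<open>w\<close> into a vanishing L1 norm.\<close>
  have bound: "(\<integral>t. indicator (E T) t * norm (w t) \<partial>lebesgue)\<^sup>2 \<le> 4 * \<bar>a\<bar> * (\<integral>t. indicator (E T) t *\<^sub>R (norm (w t))\<^sup>2 \<partial>lebesgue)" for T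
  proof -
    have wn: "square_integrable lebesgue (\<lambda>t. norm (w t))" using w by (simp add: square_integrable_def)
    have i1: "integrable lebesgue (\<lambda>t. indicator (E T) t * norm (w t))"
      by (rule square_integrable_mult[OF E2 wn])
    have i2: "integrable lebesgue (\<lambda>t. indicator (E T) t *\<^sub>R (norm (w t))\<^sup>2)"
      by (rule Bochner_Integration.integrable_bound[OF w2]) (auto split: split_indicator)
    have "(\<integral>\<^sup>+t. ennreal (indicator (E T) t * norm (w t)) \<partial>lebesgue)\<^sup>2
      = (\<integral>\<^sup>+t. indicator (E T) t * ennreal (indicator (E T) t * norm (w t)) \<partial>lebesgue)\<^sup>2"
      by (intro arg_cong[where f="\<lambda>x. x\<^sup>2"] nn_integral_cong) (auto split: split_indicator)
    also have "\<dots> \<le> (\<integral>\<^sup>+t. (indicator (E T) t)\<^sup>2 \<partial>lebesgue) * (\<integral>\<^sup>+t. (ennreal (indicator (E T) t * norm (w t)))\<^sup>2 \<partial>lebesgue)"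
      by (rule Cauchy_Schwarz_nn_integral) measurable
    also have "(\<integral>\<^sup>+t. (indicator (E T) t)\<^sup>2 \<partial>lebesgue) = emeasure lebesgue (E T)"
      by (rule trans[OF nn_integral_cong nn_integral_indicator[OF E]]) (auto split: split_indicator)
    also have "(\<integral>\<^sup>+t. (ennreal (indicator (E T) t * norm (w t)))\<^sup>2 \<partial>lebesgue) = (\<integral>\<^sup>+t. ennreal (indicator (E T) t *\<^sub>R (norm (w t))\<^sup>2) \<partial>lebesgue)"
      by (intro nn_integral_cong) (auto split: split_indicator simp: ennreal_power)
    also have "\<dots> = ennreal (\<integral>t. indicator (E T) t *\<^sub>R (norm (w t))\<^sup>2 \<partial>lebesgue)"
      by (rule nn_integral_eq_integral[OF i2]) simp
    also have "(\<integral>\<^sup>+t. ennreal (indicator (E T) t * norm (w t)) \<partial>lebesgue) = ennreal (\<integral>t. indicator (E T) t * norm (w t) \<partial>lebesgue)"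
      by (rule nn_integral_eq_integral[OF i1]) simp
    finally have "(ennreal (\<integral>t. indicator (E T) t * norm (w t) \<partial>lebesgue))\<^sup>2
       \<le> emeasure lebesgue (E T) * ennreal (\<integral>t. indicator (E T) t *\<^sub>R (norm (w t))\<^sup>2 \<partial>lebesgue)" .
    also have "\<dots> \<le> ennreal (4 * \<bar>a\<bar>) * ennreal (\<integral>t. indicator (E T) t *\<^sub>R (norm (w t))\<^sup>2 \<partial>lebesgue)"
      by (rule mult_right_mono[OF em]) simp
    also have "\<dots> = ennreal (4 * \<bar>a\<bar> * (\<integral>t. indicator (E T) t *\<^sub>R (norm (w t))\<^sup>2 \<partial>lebesgue))"
      by (rule ennreal_mult'[symmetric]) simp
    also have "(ennreal (\<integral>t. indicator (E T) t * norm (w t) \<partial>lebesgue))\<^sup>2 = ennreal ((\<integral>t. indicator (E T) t * norm (w t) \<partial>lebesgue)\<^sup>2)"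
      by (rule ennreal_power) simp
    finally show ?thesis
      by (rule ennreal_le_iff[THEN iffD1, rotated]) (intro mult_nonneg_nonneg Bochner_Integration.integral_nonneg; simp)
  qed
  have "((\<lambda>T. 4 * \<bar>a\<bar> * (\<integral>t. indicator (E T) t *\<^sub>R (norm (w t))\<^sup>2 \<partial>lebesgue)) \<longlongrightarrow> 4 * \<bar>a\<bar> * 0) at_top"
    using Y by (intro tendsto_mult tendsto_const) simp
  then have lim0: "((\<lambda>T. 4 * \<bar>a\<bar> * (\<integral>t. indicator (E T) t *\<^sub>R (norm (w t))\<^sup>2 \<partial>lebesgue)) \<longlongrightarrow> 0) at_top"
    by simp
  have "((\<lambda>T. (\<integral>t. indicator (E T) t * norm (w t) \<partial>lebesgue)\<^sup>2) \<longlongrightarrow> 0) at_top"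
    by (rule tendsto_sandwich[OF _ _ tendsto_const lim0]; rule always_eventually; rule allI; (rule zero_le_power2 | rule bound))
  then have "((\<lambda>T. sqrt ((\<integral>t. indicator (E T) t * norm (w t) \<partial>lebesgue)\<^sup>2)) \<longlongrightarrow> sqrt 0) at_top"
    by (rule tendsto_real_sqrt)
  then show ?thesis by (simp add: tendsto_rabs_zero_iff E_def)
qed

text \<open>A shift by a multiplies the transform by \<open>cis (- (\<omega> * a))\<close> and moves
  the window to \<open>[-T - a, T - a]\<close>. The L2 error of the unshifted truncation is
  controlled because \<open>\<psi>\<close> is bounded; the error of the window, at most a constant
  for all \<omega>, is controlled because \<open>\<psi>\<close> is square integrable.\<close>

lemma tendsto_L2_shifted_truncated_fourier:
  fixes w :: "real \<Rightarrow> complex" and \<psi> :: "real \<Rightarrow> complex"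
  assumes w: "has_fourier_transform w v"
    and \<psi>: "square_integrable lebesgue \<psi>" and B: "AE \<omega> in lebesgue. norm (\<psi> \<omega>) \<le> B"
  shows "tendsto_L2 lebesgue (\<lambda>T \<omega>. \<psi> \<omega> * truncated_fourier T (\<lambda>t. w (t - a)) \<omega>)
    (\<lambda>\<omega>. \<psi> \<omega> * (cis (- (\<omega> * a)) * v \<omega>)) at_top"
proof -
  have w2: "square_integrable lebesgue w" and v2: "square_integrable lebesgue v"
    and lim: "tendsto_L2 lebesgue (\<lambda>T. truncated_fourier T w) v at_top"
    using w by (simp_all add: has_fourier_transform_def truncated_fourier_def[abs_def])
  have [measurable]: "w \<in> borel_measurable lebesgue" "v \<in> borel_measurable lebesgue" "\<psi> \<in> borel_measurable lebesgue"
    using w2 v2 \<psi> by (simp_all add: square_integrable_def)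
  define E where "E T = {-T-\<bar>a\<bar>..-T+\<bar>a\<bar>} \<union> {T-\<bar>a\<bar>..T+\<bar>a\<bar>}" for T
  define \<delta> where "\<delta> T = (\<integral>t. indicator (E T) t * norm (w t) \<partial>lebesgue)" for T
  have \<delta>: "(\<delta> \<longlongrightarrow> 0) at_top" unfolding \<delta>_def[abs_def] E_def by (rule window_shift_tendsto_0[OF w2])
  \<comment> \<open>A substitution in t reduces the difference to integrals of \<open>w\<close>,
    times a unimodular factor, over the places where the two windows differ.\<close>
  have D: "norm (truncated_fourier T (\<lambda>t. w (t - a)) \<omega> - cis (- (\<omega> * a)) * truncated_fourier T w \<omega>) \<le> \<delta> T" for T \<omega>
  proof -
    define p where "p t = cis (- (\<omega> * t))" for t
    have pm[measurable]: "p \<in> borel_measurable lebesgue"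
      unfolding p_def by (rule borel_imp_lebesgue_measurable) measurable
    have pn: "norm (p t) = 1" for t by (simp add: p_def)
    have pa: "p (a + t) = p a * p t" for t by (simp add: p_def cis_mult distrib_left)
    have i1: "integrable lebesgue (\<lambda>t. (indicator {-T-a..T-a} t * w t) * p t)"
      and i2: "integrable lebesgue (\<lambda>t. (indicator {-T..T} t * w t) * p t)"
      by (rule integrable_mult_bounded[OF integrable_indicator_square_integrable[OF w2], where C=1]; simp add: pn)+
    have "truncated_fourier T (\<lambda>t. w (t - a)) \<omega> = (\<integral>t. (indicator {-T..T} t * w (t - a)) * p t \<partial>lebesgue)"
      by (simp add: truncated_fourier_eq p_def)
    also have "\<dots> = (\<integral>t. (indicator {-T..T} (a + 1 * t) * w (a + 1 * t - a)) * p (a + 1 * t) \<partial>lebesgue)"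
      by (subst lebesgue_integral_real_affine[where c=1 and t=a]) simp_all
    also have "\<dots> = (\<integral>t. p a * ((indicator {-T-a..T-a} t * w t) * p t) \<partial>lebesgue)"
      by (rule Bochner_Integration.integral_cong) (auto simp: pa split: split_indicator)
    also have "\<dots> = p a * (\<integral>t. (indicator {-T-a..T-a} t * w t) * p t \<partial>lebesgue)"
      by (rule integral_mult_right_zero)
    finally have "truncated_fourier T (\<lambda>t. w (t - a)) \<omega> - cis (- (\<omega> * a)) * truncated_fourier T w \<omega>
      = p a * ((\<integral>t. (indicator {-T-a..T-a} t * w t) * p t \<partial>lebesgue) - (\<integral>t. (indicator {-T..T} t * w t) * p t \<partial>lebesgue))"
      by (simp add: truncated_fourier_eq p_def right_diff_distrib)
    also have "\<dots> = p a * (\<integral>t. (indicator {-T-a..T-a} t * w t) * p t - (indicator {-T..T} t * w t) * p t \<partial>lebesgue)"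
      using i1 i2 by simp
    finally have "norm (truncated_fourier T (\<lambda>t. w (t - a)) \<omega> - cis (- (\<omega> * a)) * truncated_fourier T w \<omega>)
      = norm (\<integral>t. (indicator {-T-a..T-a} t * w t) * p t - (indicator {-T..T} t * w t) * p t \<partial>lebesgue)"
      by (simp add: norm_mult pn)
    also have "\<dots> \<le> (\<integral>t. norm ((indicator {-T-a..T-a} t * w t) * p t - (indicator {-T..T} t * w t) * p t) \<partial>lebesgue)"
      by (rule integral_norm_bound)
    also have "\<dots> \<le> \<delta> T"
      unfolding \<delta>_def
    proof (rule integral_mono)
      show "integrable lebesgue (\<lambda>t. norm ((indicator {-T-a..T-a} t * w t) * p t - (indicator {-T..T} t * w t) * p t))"
        using i1 i2 by simp
      have "integrable lebesgue (\<lambda>t. norm (indicator {-T-\<bar>a\<bar>..-T+\<bar>a\<bar>} t * w t) + norm (indicator {T-\<bar>a\<bar>..T+\<bar>a\<bar>} t * w t))"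
        by (intro Bochner_Integration.integrable_add integrable_norm integrable_indicator_square_integrable[OF w2])
      then show "integrable lebesgue (\<lambda>t. indicator (E T) t * norm (w t))"
      proof (rule Bochner_Integration.integrable_bound)
        have [measurable]: "E T \<in> sets lebesgue" by (simp add: E_def)
        show "(\<lambda>t. indicator (E T) t * norm (w t)) \<in> borel_measurable lebesgue" by measurable
        show "AE t in lebesgue. norm (indicator (E T) t * norm (w t))
          \<le> norm (norm (indicator {-T-\<bar>a\<bar>..-T+\<bar>a\<bar>} t * w t) + norm (indicator {T-\<bar>a\<bar>..T+\<bar>a\<bar>} t * w t))"
        proof (rule AE_I2)
          fix t :: real
          show "norm (indicator (E T) t * norm (w t))
            \<le> norm (norm (indicator {-T-\<bar>a\<bar>..-T+\<bar>a\<bar>} t * w t) + norm (indicator {T-\<bar>a\<bar>..T+\<bar>a\<bar>} t * w t))"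
            by (cases "t \<in> {-T-\<bar>a\<bar>..-T+\<bar>a\<bar>}"; cases "t \<in> {T-\<bar>a\<bar>..T+\<bar>a\<bar>}")
              (simp_all add: E_def norm_mult del: atLeastAtMost_iff)
        qed
      qed
      show "norm ((indicator {-T-a..T-a} t * w t) * p t - (indicator {-T..T} t * w t) * p t) \<le> indicator (E T) t * norm (w t)" for t
      proof -
        have "(indicator {-T-a..T-a} t * w t) * p t - (indicator {-T..T} t * w t) * p t
          = (indicator {-T-a..T-a} t - indicator {-T..T} t) * (w t * p t)"
          by (simp add: algebra_simps)
        also have "norm \<dots> = norm (indicator {-T-a..T-a} t - indicator {-T..T} t :: complex) * norm (w t)"
          by (simp add: norm_mult pn)
        also have "\<dots> \<le> indicator (E T) t * norm (w t)"
        proof (rule mult_right_mono)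
          \<comment> \<open>The windows can disagree only within |a| of -T or of T;
            \<open>E T\<close> covers these places for either sign of a.\<close>
          have "t \<in> {-T-a..T-a} \<longleftrightarrow> t \<in> {-T..T}" if "t \<notin> E T"
            using that unfolding E_def Un_iff atLeastAtMost_iff by linarith
          then show "norm (indicator {-T-a..T-a} t - indicator {-T..T} t :: complex) \<le> indicator (E T) t"
            by (cases "t \<in> E T") (auto simp del: atLeastAtMost_iff split: split_indicator)
        qed simp
        finally show ?thesis .
      qed
    qed
    finally show ?thesis .
  qed
  define e where "e T = (\<integral>\<^sup>+\<omega>. ennreal ((norm (truncated_fourier T w \<omega> - v \<omega>))\<^sup>2) \<partial>lebesgue)" for T
  have e: "(e \<longlongrightarrow> 0) at_top" using lim by (simp add: tendsto_L2_def e_def[abs_def])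
  define q where "q = (\<integral>\<^sup>+\<omega>. ennreal ((norm (\<psi> \<omega>))\<^sup>2) \<partial>lebesgue)"
  have q: "q < \<infinity>" unfolding q_def by (rule square_integrable_nn_finite[OF \<psi>])
  have le: "(\<integral>\<^sup>+\<omega>. ennreal ((norm (\<psi> \<omega> * truncated_fourier T (\<lambda>t. w (t - a)) \<omega> - \<psi> \<omega> * (cis (- (\<omega> * a)) * v \<omega>)))\<^sup>2) \<partial>lebesgue)
     \<le> ennreal (2 * B\<^sup>2) * e T + ennreal (2 * (\<delta> T)\<^sup>2) * q" for T
  proof -
    have tm[measurable]: "truncated_fourier T w \<in> borel_measurable lebesgue" by (rule truncated_fourier_measurable) simp
    have "(\<integral>\<^sup>+\<omega>. ennreal ((norm (\<psi> \<omega> * truncated_fourier T (\<lambda>t. w (t - a)) \<omega> - \<psi> \<omega> * (cis (- (\<omega> * a)) * v \<omega>)))\<^sup>2) \<partial>lebesgue)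
      \<le> (\<integral>\<^sup>+\<omega>. ennreal (2 * B\<^sup>2) * ennreal ((norm (truncated_fourier T w \<omega> - v \<omega>))\<^sup>2)
          + ennreal (2 * (\<delta> T)\<^sup>2) * ennreal ((norm (\<psi> \<omega>))\<^sup>2) \<partial>lebesgue)"
    proof (rule nn_integral_mono_AE)
      show "AE \<omega> in lebesgue. ennreal ((norm (\<psi> \<omega> * truncated_fourier T (\<lambda>t. w (t - a)) \<omega> - \<psi> \<omega> * (cis (- (\<omega> * a)) * v \<omega>)))\<^sup>2)
        \<le> ennreal (2 * B\<^sup>2) * ennreal ((norm (truncated_fourier T w \<omega> - v \<omega>))\<^sup>2)
          + ennreal (2 * (\<delta> T)\<^sup>2) * ennreal ((norm (\<psi> \<omega>))\<^sup>2)"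
        using B
      proof eventually_elim
        case (elim \<omega>)
        define x where "x = truncated_fourier T (\<lambda>t. w (t - a)) \<omega> - cis (- (\<omega> * a)) * truncated_fourier T w \<omega>"
        define y where "y = truncated_fourier T w \<omega> - v \<omega>"
        have eq: "\<psi> \<omega> * truncated_fourier T (\<lambda>t. w (t - a)) \<omega> - \<psi> \<omega> * (cis (- (\<omega> * a)) * v \<omega>)
          = \<psi> \<omega> * (cis (- (\<omega> * a)) * y) + \<psi> \<omega> * x"
          by (simp add: x_def y_def algebra_simps)
        have "norm (\<psi> \<omega> * (cis (- (\<omega> * a)) * y) + \<psi> \<omega> * x) \<le> norm (\<psi> \<omega>) * norm y + norm (\<psi> \<omega>) * norm x"
          by (rule norm_triangle_le) (simp add: norm_mult)
        also have "\<dots> \<le> B * norm y + norm (\<psi> \<omega>) * \<delta> T"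
          using elim D[of T \<omega>] by (intro add_mono mult_right_mono mult_left_mono) (auto simp: x_def)
        finally have "(norm (\<psi> \<omega> * (cis (- (\<omega> * a)) * y) + \<psi> \<omega> * x))\<^sup>2 \<le> (B * norm y + norm (\<psi> \<omega>) * \<delta> T)\<^sup>2"
          by (rule power_mono) simp
        \<comment> \<open>(x + y)^2 \<le> 2 x^2 + 2 y^2 separates the two errors and is the origin
          of the factors 2.\<close>
        also have "\<dots> \<le> 2 * B\<^sup>2 * (norm y)\<^sup>2 + 2 * (\<delta> T)\<^sup>2 * (norm (\<psi> \<omega>))\<^sup>2"
          using sum_squares_bound[of "B * norm y" "norm (\<psi> \<omega>) * \<delta> T"] by (simp add: power2_eq_square algebra_simps)
        finally show ?case unfolding eq y_def
          by (simp flip: ennreal_mult ennreal_plus)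
      qed
    qed
    also have "\<dots> = ennreal (2 * B\<^sup>2) * e T + ennreal (2 * (\<delta> T)\<^sup>2) * q"
      unfolding e_def q_def by (subst nn_integral_add) (simp_all add: nn_integral_cmult)
    finally show ?thesis .
  qed
  have "((\<lambda>T. ennreal (2 * B\<^sup>2) * e T + ennreal (2 * (\<delta> T)\<^sup>2) * q) \<longlongrightarrow> ennreal (2 * B\<^sup>2) * 0 + ennreal (2 * 0\<^sup>2) * q) at_top"
    using q by (intro tendsto_add tendsto_mult_ennreal tendsto_ennrealI tendsto_mult tendsto_power tendsto_const e \<delta>) auto
  then have "((\<lambda>T. ennreal (2 * B\<^sup>2) * e T + ennreal (2 * (\<delta> T)\<^sup>2) * q) \<longlongrightarrow> 0) at_top" by simp
  then show ?thesis unfolding tendsto_L2_def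
    by (rule tendsto_sandwich[OF _ _ tendsto_const, rotated 2]) (simp_all add: le)
qed

lemma tendsto_L2_cnj:
  "tendsto_L2 M (\<lambda>i x. cnj (f i x)) (\<lambda>x. cnj (g x)) F \<longleftrightarrow> tendsto_L2 M f g F"
  unfolding tendsto_L2_def by (simp flip: complex_cnj_diff)

lemma cnj_measurable [measurable]: "cnj \<in> borel_measurable borel"
  by (rule borel_measurable_continuous_onI[OF continuous_on_cnj[OF continuous_on_id]])

lemma square_integrable_cnj:
  assumes "square_integrable M f" shows "square_integrable M (\<lambda>x. cnj (f x))"
  using assms measurable_compose[OF _ cnj_measurable]
  by (auto simp: square_integrable_def)

lemma square_integrable_mult_bounded:
  fixes f g :: "'a \<Rightarrow> complex"
  assumes f: "square_integrable M f" and [measurable]: "g \<in> borel_measurable M"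
    and B: "AE x in M. norm (g x) \<le> B"
  shows "square_integrable M (\<lambda>x. g x * f x)"
proof -
  have [measurable]: "f \<in> borel_measurable M" using f by (simp add: square_integrable_def)
  have "integrable M (\<lambda>x. (norm (g x * f x))\<^sup>2)"
  proof (rule Bochner_Integration.integrable_bound)
    show "integrable M (\<lambda>x. B\<^sup>2 * (norm (f x))\<^sup>2)" using f by (auto simp: square_integrable_def)
    show "AE x in M. norm ((norm (g x * f x))\<^sup>2) \<le> norm (B\<^sup>2 * (norm (f x))\<^sup>2)"
      using B
    proof eventually_elim
      case (elim x)
      then have "(norm (g x))\<^sup>2 \<le> B\<^sup>2" by (intro power_mono) auto
      then show ?case by (simp add: norm_mult power_mult_distrib mult_right_mono)
    qed
  qed measurable
  then show ?thesis by (simp add: square_integrable_def)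
qed

text \<open>T tends to infinity on both sides of \<open>expectation_qm_integrals\<close>: in L2(P)
  for the coefficients, in L2 over the frequencies for the transforms. The spectrum is attached to
  the shifted factor, whose convergence is available with such a weight.\<close>

lemma expectation_packet_coefficients:
  fixes w :: "real \<Rightarrow> real" and X :: "real \<Rightarrow> 'a \<Rightarrow> real" and \<gamma> v :: "real \<Rightarrow> complex"
  assumes X: "\<And>t. square_integrable P (X t)"
    and \<gamma>: "integrable lebesgue \<gamma>" "square_integrable lebesgue \<gamma>" "AE \<omega> in lebesgue. norm (\<gamma> \<omega>) \<le> B"
    and R: "\<And>t s. complex_of_real (\<integral>x. X t x * X s x \<partial>P) = 1 / (2 * pi) * (\<integral>\<omega>. \<gamma> \<omega> * cis (\<omega> * (t - s)) \<partial>lebesgue)"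
    and w: "has_fourier_transform (\<lambda>t. of_real (w t)) v"
    and c: "has_qm_integral P (\<lambda>t x. X t x * w (t - a)) c"
    and c': "has_qm_integral P (\<lambda>t x. X t x * w t) c'"
  shows "complex_of_real (\<integral>x. c x * c' x \<partial>P)
    = 1 / (2 * pi) * (\<integral>\<omega>. \<gamma> \<omega> * cis (\<omega> * a) * of_real ((norm (v \<omega>))\<^sup>2) \<partial>lebesgue)"
proof -
  have w2: "square_integrable lebesgue (\<lambda>t. complex_of_real (w t))" and v2: "square_integrable lebesgue v"
    and lim: "tendsto_L2 lebesgue (\<lambda>T. truncated_fourier T (\<lambda>t. of_real (w t))) v at_top"
    using w by (simp_all add: has_fourier_transform_def truncated_fourier_def[abs_def])
  have wm: "(\<lambda>t. complex_of_real (w t)) \<in> borel_measurable lebesgue" 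
    and vm[measurable]: "v \<in> borel_measurable lebesgue"
    and \<gamma>m[measurable]: "\<gamma> \<in> borel_measurable lebesgue"
    using w2 v2 \<gamma> by (simp_all add: square_integrable_def)
  have ws2: "square_integrable lebesgue (\<lambda>t. complex_of_real (w (t - a)))"
  proof -
    have "(\<lambda>t. - a + 1 * t) \<in> lebesgue \<rightarrow>\<^sub>M lebesgue"
      using lebesgue_affine_measurable[where c="\<lambda>x::real. 1" and t="-a"] by simp
    from measurable_compose[OF this wm] have m: "(\<lambda>t. complex_of_real (w (t - a))) \<in> borel_measurable lebesgue" by simp
    have "integrable lebesgue (\<lambda>t. (norm (complex_of_real (w (- a + 1 * t))))\<^sup>2)"
      using w2 by (subst lebesgue_integrable_real_affine_iff[where f="\<lambda>t. (norm (complex_of_real (w t)))\<^sup>2"]) (auto simp: square_integrable_def)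
    then show ?thesis using m by (simp add: square_integrable_def)
  qed
  have wsm: "(\<lambda>t. complex_of_real (w (t - a))) \<in> borel_measurable lebesgue" using ws2 by (simp add: square_integrable_def)
  obtain I where I: "\<And>T. T > 0 \<Longrightarrow> has_qm_integral_on P (\<lambda>t x. X t x * w (t - a)) (I T) (-T) T" "tendsto_L2 P I c at_top"
    and c2: "square_integrable P c"
    using c unfolding has_qm_integral_def by blast
  obtain J where J: "\<And>T. T > 0 \<Longrightarrow> has_qm_integral_on P (\<lambda>t x. X t x * w t) (J T) (-T) T" "tendsto_L2 P J c' at_top"
    and c'2: "square_integrable P c'"
    using c' unfolding has_qm_integral_def by blast
  \<comment> \<open>\<open>I T\<close> is constrained only for T > 0. The other values are replaced
    by the limit because \<open>tendsto_L2_integral_mult\<close> asks for measurability at every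
    index.\<close>
  define I' where "I' T = (if T > 0 then I T else c)" for T
  define J' where "J' T = (if T > 0 then J T else c')" for T
  have I'm: "I' T \<in> borel_measurable P" and J'm: "J' T \<in> borel_measurable P" for T
    using I(1)[of T] J(1)[of T] c2 c'2
    by (auto simp: I'_def J'_def has_qm_integral_on_def square_integrable_def)
  have pos: "\<forall>\<^sub>F T::real in at_top. T > 0" by (rule eventually_gt_at_top)
  have I'L: "tendsto_L2 P I' c at_top"
    using I(2) unfolding tendsto_L2_def
    by (rule Lim_transform_eventually) (use pos in \<open>eventually_elim; simp add: I'_def\<close>)
  have J'L: "tendsto_L2 P J' c' at_top"
    using J(2) unfolding tendsto_L2_def
    by (rule Lim_transform_eventually) (use pos in \<open>eventually_elim; simp add: J'_def\<close>)
  have 1: "((\<lambda>T. complex_of_real (\<integral>x. I' T x * J' T x \<partial>P)) \<longlongrightarrow> complex_of_real (\<integral>x. c x * c' x \<partial>P)) at_top"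
    by (intro tendsto_of_real tendsto_L2_integral_mult I'L J'L c2 c'2 I'm J'm)
  let ?F = "\<lambda>T. truncated_fourier T (\<lambda>t. complex_of_real (w (t - a)))"
  let ?G = "\<lambda>T. truncated_fourier T (\<lambda>t. complex_of_real (w t))"
  \<comment> \<open>The shift lemma concerns the transform, while its conjugate occurs here; so it
    is applied with the weight \<open>cnj (\<gamma> \<omega>)\<close> and the result is
    conjugated.\<close>
  have cg: "square_integrable lebesgue (\<lambda>\<omega>. cnj (\<gamma> \<omega>))" "AE \<omega> in lebesgue. norm (cnj (\<gamma> \<omega>)) \<le> B"
    using \<gamma> square_integrable_cnj by auto
  have cism: "(\<lambda>\<omega>. cis (- (\<omega> * a))) \<in> borel_measurable lebesgue"
    by (rule borel_imp_lebesgue_measurable) measurable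
  have L: "tendsto_L2 lebesgue (\<lambda>T \<omega>. \<gamma> \<omega> * cnj (?F T \<omega>)) (\<lambda>\<omega>. \<gamma> \<omega> * cnj (cis (- (\<omega> * a)) * v \<omega>)) at_top"
    using tendsto_L2_shifted_truncated_fourier[OF w cg, of a]
    by (subst tendsto_L2_cnj[symmetric]) simp
  have 2: "((\<lambda>T. \<integral>\<omega>. \<gamma> \<omega> * cnj (?F T \<omega>) * ?G T \<omega> \<partial>lebesgue) \<longlongrightarrow>
      (\<integral>\<omega>. \<gamma> \<omega> * cnj (cis (- (\<omega> * a)) * v \<omega>) * v \<omega> \<partial>lebesgue)) at_top"
  proof (rule tendsto_L2_integral_mult[OF L lim _ v2])
    have "square_integrable lebesgue (\<lambda>\<omega>. cnj (cis (- (\<omega> * a)) * v \<omega>))"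
      by (intro square_integrable_cnj square_integrable_mult_bounded[OF v2 cism, of 1]) simp
    then show "square_integrable lebesgue (\<lambda>\<omega>. \<gamma> \<omega> * cnj (cis (- (\<omega> * a)) * v \<omega>))"
      by (rule square_integrable_mult_bounded) (use \<gamma> in auto)
    show "(\<lambda>\<omega>. \<gamma> \<omega> * cnj (?F T \<omega>)) \<in> borel_measurable lebesgue" for T
      using truncated_fourier_measurable[OF wsm, of T] by measurable
    show "?G T \<in> borel_measurable lebesgue" for T by (rule truncated_fourier_measurable[OF wm])
  qed
  have "((\<lambda>T. complex_of_real (\<integral>x. I' T x * J' T x \<partial>P)) \<longlongrightarrow> 1 / (2 * pi) *
      (\<integral>\<omega>. \<gamma> \<omega> * cnj (cis (- (\<omega> * a)) * v \<omega>) * v \<omega> \<partial>lebesgue)) at_top"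
  proof (rule Lim_transform_eventually)
    show "((\<lambda>T. complex_of_real (1 / (2 * pi)) * (\<integral>\<omega>. \<gamma> \<omega> * cnj (?F T \<omega>) * ?G T \<omega> \<partial>lebesgue)) \<longlongrightarrow> 1 / (2 * pi) *
      (\<integral>\<omega>. \<gamma> \<omega> * cnj (cis (- (\<omega> * a)) * v \<omega>) * v \<omega> \<partial>lebesgue)) at_top"
      using tendsto_mult[OF tendsto_const 2, of "complex_of_real (1 / (2 * pi))"] by simp
    show "\<forall>\<^sub>F T in at_top. complex_of_real (1 / (2 * pi)) * (\<integral>\<omega>. \<gamma> \<omega> * cnj (?F T \<omega>) * ?G T \<omega> \<partial>lebesgue)
      = complex_of_real (\<integral>x. I' T x * J' T x \<partial>P)"
      using pos
    proof eventually_elim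
      case (elim T)
      then show ?case
        using expectation_qm_integrals[OF X \<gamma>(1) R ws2 w2 I(1) J(1)] by (simp add: I'_def J'_def)
    qed
  qed
  with 1 have "complex_of_real (\<integral>x. c x * c' x \<partial>P) = 1 / (2 * pi) *
      (\<integral>\<omega>. \<gamma> \<omega> * cnj (cis (- (\<omega> * a)) * v \<omega>) * v \<omega> \<partial>lebesgue)"
    by (rule tendsto_unique[rotated]) simp
  also have "(\<integral>\<omega>. \<gamma> \<omega> * cnj (cis (- (\<omega> * a)) * v \<omega>) * v \<omega> \<partial>lebesgue)
     = (\<integral>\<omega>. \<gamma> \<omega> * cis (\<omega> * a) * of_real ((norm (v \<omega>))\<^sup>2) \<partial>lebesgue)"
    by (intro Bochner_Integration.integral_cong refl)
      (simp add: cis_cnj complex_norm_square[symmetric] mult.assoc mult.commute[of "cnj _"] del: of_real_power)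
  finally show ?thesis .
qed

section \<open>Shannon filters and the frequency ordering\<close>

lemma shannon_filter_periodic: "shannon_filter M m (\<theta> + 2 * pi) = shannon_filter M m \<theta>"
proof -
  have b: "bij_betw (\<lambda>l::int. l + 1) UNIV UNIV" by (rule bij_betw_byWitness[where f'="\<lambda>l. l - 1"]) auto
  have "shannon_filter M m (\<theta> + 2 * pi) = (\<Sum>\<^sub>\<infinity>l\<in>(UNIV::int set). indicator (shannon_band M m) (\<theta> + 2 * pi - 2 * pi * of_int (l + 1)))"
    unfolding shannon_filter_def by (rule infsum_reindex_bij_betw[OF b, symmetric])
  also have "\<dots> = shannon_filter M m \<theta>"
    unfolding shannon_filter_def by (rule infsum_cong) (simp add: algebra_simps)
  finally show ?thesis .
qed

lemma indicator_shannon_band_minus: "indicator (shannon_band M m) (- x) = (indicator (shannon_band M m) x :: real)"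
  by (auto simp: indicator_def shannon_band_def)

lemma shannon_filter_minus: "shannon_filter M m (- \<theta>) = shannon_filter M m \<theta>"
proof -
  have b: "bij_betw (\<lambda>l::int. - l) UNIV UNIV" by (rule bij_betw_byWitness[where f'="\<lambda>l. - l"]) auto
  have "shannon_filter M m (- \<theta>) = (\<Sum>\<^sub>\<infinity>l\<in>(UNIV::int set). indicator (shannon_band M m) (- \<theta> - 2 * pi * of_int (- l)))"
    unfolding shannon_filter_def by (rule infsum_reindex_bij_betw[OF b, symmetric])
  also have "\<dots> = shannon_filter M m \<theta>"
    unfolding shannon_filter_def 
  proof (rule infsum_cong)
    fix l :: int
    have "- \<theta> - 2 * pi * of_int (- l) = - (\<theta> - 2 * pi * of_int l)" by simp
    then show "indicator (shannon_band M m) (- \<theta> - 2 * pi * of_int (- l)) = (indicator (shannon_band M m) (\<theta> - 2 * pi * of_int l) :: real)"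
      by (simp only: indicator_shannon_band_minus)
  qed
  finally show ?thesis .
qed

text \<open>Translates with l \<noteq> 0 carry the argument outside \<open>[-pi, pi]\<close>, which
  contains the band. Strictness of u < 1 matters: at u = 1 and m = M - 1 the translates l = 0 and l
  = 1 both count, and the filter takes the value 2.\<close>

lemma shannon_filter_base:
  assumes m: "m < M" and u: "0 < u" "u < 1"
  shows "shannon_filter M m (pi * u) = of_bool (real m \<le> M * u \<and> M * u \<le> real m + 1)"
proof -
  have Mp: "real M > 0" using m by simp
  have le: "real (m + 1) * pi / real M \<le> pi"
    using m Mp by (simp add: divide_le_eq mult.commute)
  have "indicator (shannon_band M m) (pi * u - 2 * pi * of_int l) = (0::real)" if "l \<noteq> 0" for l :: int
  proof -
    have "\<bar>pi * u - 2 * pi * of_int l\<bar> > pi"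
    proof (cases "l \<ge> 1")
      case True
      have "pi * u - 2 * pi * of_int l \<le> pi * u - 2 * pi * 1"
        using True by (intro diff_left_mono mult_left_mono) auto
      moreover have "pi * u < pi * 1" using u by (intro mult_strict_left_mono) auto
      ultimately have "pi * u - 2 * pi * of_int l < - pi" by linarith
      then show ?thesis by linarith
    next
      case False
      then have "l \<le> -1" using that by simp
      then have "of_int l \<le> (-1::real)" by simp
      then have "2 * pi * of_int l \<le> 2 * pi * (-1)" by (intro mult_left_mono) auto
      moreover have "pi * u > 0" using u by simp
      ultimately have "pi * u - 2 * pi * of_int l > pi" using pi_gt_zero by linarith
      then show ?thesis by simp
    qed
    moreover have "\<bar>x\<bar> \<le> pi" if "x \<in> shannon_band M m" for x
    proof -
      have "0 \<le> real m * pi / real M" by simp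
      then show ?thesis using that le unfolding shannon_band_def Un_iff atLeastAtMost_iff by arith
    qed
    ultimately have "pi * u - 2 * pi * of_int l \<notin> shannon_band M m" by force
    then show ?thesis by simp
  qed
  then have "shannon_filter M m (pi * u) = (\<Sum>\<^sub>\<infinity>l\<in>{0::int}. indicator (shannon_band M m) (pi * u - 2 * pi * of_int l))"
    unfolding shannon_filter_def by (intro infsum_cong_neutral) auto
  also have "\<dots> = indicator (shannon_band M m) (pi * u)" by simp
  also have "\<dots> = of_bool (real m \<le> M * u \<and> M * u \<le> real m + 1)"
  proof -
    have "0 \<le> real m * pi / real M" "pi * u > 0" using u by auto
    then have "pi * u \<in> shannon_band M m \<longleftrightarrow> pi * u \<in> {real m * pi / real M .. real (m + 1) * pi / real M}"
      unfolding shannon_band_def Un_iff atLeastAtMost_iff by arith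
    also have "\<dots> \<longleftrightarrow> pi * real m \<le> pi * (M * u) \<and> pi * (M * u) \<le> pi * (real m + 1)"
      using Mp by (simp add: divide_le_eq le_divide_eq mult_ac) (simp add: algebra_simps)
    also have "\<dots> \<longleftrightarrow> real m \<le> M * u \<and> M * u \<le> real m + 1"
      by (simp only: mult_le_cancel_left_pos[OF pi_gt_zero])
    finally show ?thesis by (simp add: indicator_def)
  qed
  finally show ?thesis .
qed

lemma shannon_filter_shift: "shannon_filter M m (\<theta> + 2 * pi * real q) = shannon_filter M m \<theta>"
proof (induction q)
  case (Suc q)
  have "shannon_filter M m (\<theta> + 2 * pi * real (Suc q)) = shannon_filter M m ((\<theta> + 2 * pi * real q) + 2 * pi)"
    by (simp add: algebra_simps)
  then show ?case by (simp only: shannon_filter_periodic Suc)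
qed simp

text \<open>For even q the interval is a translate of (0, pi) by a period. For odd q it is the image
  of (0, pi) under v -> (q + 1) pi - v, where (q + 1) pi is a period; the filter being even,
  sub-band m is then found at position M - 1 - m. This is the source of the two cases in
  \<open>packet_perm\<close>.\<close>

lemma shannon_filter_interval:
  assumes m: "m < M" and u: "real q < u" "u < real q + 1"
  shows "shannon_filter M m (pi * u) =
    (if even q then of_bool (real (M * q + m) \<le> M * u \<and> M * u \<le> real (M * q + m) + 1)
     else of_bool (real (M * q + M - 1 - m) \<le> M * u \<and> M * u \<le> real (M * q + M - 1 - m) + 1))"
proof (cases "even q")
  case True
  then obtain r where r: "q = 2 * r" by blast
  have "pi * u = pi * (u - real q) + 2 * pi * real r" by (simp add: r algebra_simps)
  then have "shannon_filter M m (pi * u) = shannon_filter M m (pi * (u - real q))"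
    by (simp only: shannon_filter_shift)
  also have "\<dots> = of_bool (real m \<le> M * (u - real q) \<and> M * (u - real q) \<le> real m + 1)"
    using u by (intro shannon_filter_base m) auto
  finally show ?thesis using True by (auto simp: algebra_simps)
next
  case False
  then obtain r where r: "q + 1 = 2 * r" by (metis even_Suc dvdE Suc_eq_plus1)
  then have r': "2 * real r = real q + 1" by linarith
  have "pi * u = - (pi * (real q + 1 - u)) + 2 * pi * real r"
    using r' by (metis (no_types, opaque_lifting) add.commute add_diff_cancel_left' diff_add_cancel
      minus_diff_eq mult.assoc mult.commute right_diff_distrib uminus_add_conv_diff)
  then have "shannon_filter M m (pi * u) = shannon_filter M m (pi * (real q + 1 - u))"
    by (simp only: shannon_filter_shift shannon_filter_minus)
  also have "\<dots> = of_bool (real m \<le> M * (real q + 1 - u) \<and> M * (real q + 1 - u) \<le> real m + 1)"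
    using u by (intro shannon_filter_base m) auto
  also have "\<dots> = of_bool (real (M * q + M - 1 - m) \<le> M * u \<and> M * u \<le> real (M * q + M - 1 - m) + 1)"
  proof -
    have "real (M * q + M - 1 - m) = real M * real q + real M - 1 - real m"
      using m by (simp add: of_nat_diff)
    then show ?thesis by (auto simp: algebra_simps)
  qed
  finally show ?thesis using False by simp
qed

section \<open>The frequency ordering along a path\<close>

text \<open>Moves the subtraction to the end. An odd index is at least 1, so M times it exceeds the
  digit and no subtraction of natural numbers is truncated.\<close>

lemma packet_perm_node_index_Suc:
  assumes "2 \<le> M" "m (Suc j) < M"
  shows "packet_perm M (node_index M m (Suc j)) =
    (if even (packet_perm M (node_index M m j)) then M * packet_perm M (node_index M m j) + m (Suc j)
     else M * packet_perm M (node_index M m j) + M - 1 - m (Suc j))"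
proof -
  have "m (Suc j) < M * p" if "odd p" for p
    using assms(2) that mult_le_mono2[of 1 p M] by (cases p) auto
  then show ?thesis using assms unfolding node_index_Suc by (subst packet_perm_rec) (auto simp: less_imp_le)
qed

text \<open>Either parity places the new index among M p, ..., M p + M - 1, where p is the old one:
  bands along a path are nested.\<close>

lemma packet_perm_node_index_bounds:
  assumes "2 \<le> M" "m (Suc j) < M"
  shows "M * packet_perm M (node_index M m j) \<le> packet_perm M (node_index M m (Suc j))"
    and "packet_perm M (node_index M m (Suc j)) + 1 \<le> M * (packet_perm M (node_index M m j) + 1)"
  using assms by (auto simp: packet_perm_node_index_Suc)

text \<open>With x = M^j u, the first j filters confine x to \<open>[p, p + 1]\<close>. The next
  one, evaluated at \<open>pi * x\<close>, selects one of M equal pieces of this interval, by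
  \<open>shannon_filter_interval\<close> with q = p; the parity of p orders the pieces just as in
  \<open>packet_perm\<close>.\<close>

lemma prod_shannon_filter:
  assumes M: "2 \<le> M" and m: "\<And>l. l \<ge> 1 \<Longrightarrow> m l < M"
    and u: "0 < u" "u < 1" and gen: "real M ^ j * u \<notin> \<int>"
  shows "(\<Prod>l=1..j. shannon_filter M (m l) (real M ^ (l - 1) * (pi * u))) =
    of_bool (real (packet_perm M (node_index M m j)) \<le> real M ^ j * u \<and>
             real M ^ j * u \<le> real (packet_perm M (node_index M m j)) + 1)"
  using gen
proof (induction j)
  case 0
  then show ?case using u by (simp add: node_index_def packet_perm_0)
next
  case (Suc j)
  let ?p = "packet_perm M (node_index M m j)" and ?p' = "packet_perm M (node_index M m (Suc j))"
  let ?x = "real M ^ j * u"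
  have x': "real M ^ Suc j * u = real M * ?x" by simp
  \<comment> \<open>Genericity descends from level j + 1 to level j, since M times an integer is an
    integer.\<close>
  have gen: "?x \<notin> \<int>" using Suc.prems Ints_mult[OF Ints_of_nat[of M], of ?x] unfolding x' by blast
  have ms: "m (Suc j) < M" using m by simp
  have IH: "(\<Prod>l=1..Suc j. shannon_filter M (m l) (real M ^ (l - 1) * (pi * u)))
     = of_bool (real ?p \<le> ?x \<and> ?x \<le> real ?p + 1) * shannon_filter M (m (Suc j)) (pi * ?x)"
    using Suc.IH[OF gen] by (simp add: mult_ac)
  show ?case
  proof (cases "real ?p \<le> ?x \<and> ?x \<le> real ?p + 1")
    case True
    have "?x \<noteq> real ?p" "?x \<noteq> real ?p + 1" using gen by auto
    then have s: "real ?p < ?x" "?x < real ?p + 1" using True by auto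
    have "shannon_filter M (m (Suc j)) (pi * ?x) = of_bool (real ?p' \<le> M * ?x \<and> M * ?x \<le> real ?p' + 1)"
      unfolding shannon_filter_interval[OF ms s] packet_perm_node_index_Suc[of M m j, OF M ms] by simp
    then show ?thesis using True unfolding IH x' by simp
  next
    case False
    \<comment> \<open>Outside the old interval the product is already 0; nesting makes the new
      indicator 0 as well.\<close>
    have b: "real M * real ?p \<le> real ?p'" "real ?p' + 1 \<le> real M * (real ?p + 1)"
      using packet_perm_node_index_bounds[of M m j, OF M ms, THEN of_nat_mono[where 'a=real]]
      by (simp_all add: algebra_simps)
    have "\<not> (real ?p' \<le> M * ?x \<and> M * ?x \<le> real ?p' + 1)"
    proof
      assume "real ?p' \<le> M * ?x \<and> M * ?x \<le> real ?p' + 1"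
      with b have "real M * real ?p \<le> real M * ?x" "real M * ?x \<le> real M * (real ?p + 1)" by linarith+
      then show False using False M by (simp del: distrib_left_numeral)
    qed
    then have z: "(of_bool (real ?p' \<le> M * ?x \<and> M * ?x \<le> real ?p' + 1) :: real) = 0" by (simp only: of_bool_eq)
    have z': "(of_bool (real ?p \<le> ?x \<and> ?x \<le> real ?p + 1) :: real) = 0" using False by (simp only: of_bool_eq)
    show ?thesis unfolding IH x' z z' by simp
  qed
qed

text \<open>Puts the band inside \<open>[0, pi]\<close>, so the cutoff in
  \<open>shannon_packet_ft\<close> removes nothing of it.\<close>

lemma packet_perm_node_index_less:
  assumes M: "2 \<le> M" and m: "\<And>l. l \<ge> 1 \<Longrightarrow> m l < M"
  shows "packet_perm M (node_index M m j) < M ^ j"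
proof (induction j)
  case 0
  then show ?case by (simp add: node_index_def packet_perm_0)
next
  case (Suc j)
  have "packet_perm M (node_index M m (Suc j)) + 1 \<le> M * (packet_perm M (node_index M m j) + 1)"
    using M m by (intro packet_perm_node_index_bounds) auto
  also have "\<dots> \<le> M * M ^ j" using Suc by (intro mult_left_mono) auto
  finally show ?case by simp
qed

lemma node_index_less:
  assumes "2 \<le> M" and "\<And>l. l \<ge> 1 \<Longrightarrow> m l < M"
  shows "node_index M m j < M ^ j"
proof (induction j)
  case 0
  then show ?case by (simp add: node_index_def)
next
  case (Suc j)
  have "M * node_index M m j + m (Suc j) < M * node_index M m j + M" using assms(2)[of "Suc j"] by simp
  also have "\<dots> = M * (node_index M m j + 1)" by simp
  also have "\<dots> \<le> M * M ^ j" using Suc by (intro mult_left_mono) auto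
  finally show ?case by (simp add: node_index_Suc)
qed

section \<open>Frequency support of the packets\<close>

definition packet_band :: "nat \<Rightarrow> nat \<Rightarrow> nat \<Rightarrow> real set" where
  "packet_band M j p = {real p * pi / real M ^ j .. (real p + 1) * pi / real M ^ j}"

text \<open>Equality can fail only at multiples of pi / M^j: filter values at band edges may be
  irregular, and at 0 both indicators may count. The amplitude \<open>M powr (j / 2)\<close> squares
  to M^j.\<close>

lemma shannon_packet_ft_squared_AE:
  assumes M: "2 \<le> M" and m: "\<And>l. l \<ge> 1 \<Longrightarrow> m l < M"
  shows "AE \<omega> in lebesgue. (shannon_packet_ft M j (node_index M m j) \<omega>)\<^sup>2
    = real M ^ j * (indicator (packet_band M j (packet_perm M (node_index M m j))) \<omega>
        + indicator (packet_band M j (packet_perm M (node_index M m j))) (- \<omega>))"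
proof -
  let ?p = "packet_perm M (node_index M m j)"
  have Mj: "real M ^ j > 0" using M by simp
  \<comment> \<open>Countable; it contains 0, pi, -pi and the edges of all bands up to level
    j.\<close>
  define N where "N = (\<lambda>z::int. of_int z * pi / real M ^ j) ` UNIV"
  have "N \<in> null_sets lborel" unfolding N_def by (rule countable_imp_null_set_lborel) simp
  then have "N \<in> null_sets lebesgue" by (rule null_sets_completionI)
  then have "AE \<omega> in lebesgue. \<omega> \<notin> N" by (rule AE_not_in)
  then show ?thesis
  proof eventually_elim
    case (elim \<omega>)
    define u where "u = \<bar>\<omega>\<bar> / pi"
    have absw: "\<bar>\<omega>\<bar> = pi * u" by (simp add: u_def)
    have gen: "real M ^ j * u \<notin> \<int>"
    proof
      assume "real M ^ j * u \<in> \<int>"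
      then obtain z where "real M ^ j * u = of_int z" by (auto elim: Ints_cases)
      then have a: "\<bar>\<omega>\<bar> = of_int z * pi / real M ^ j" using Mj by (simp add: absw field_simps)
      have "\<omega> \<in> N"
      proof (cases "\<omega> \<ge> 0")
        case True then show ?thesis using a by (auto simp: N_def)
      next
        case False 
        then have "\<omega> = of_int (- z) * pi / real M ^ j" using a by simp
        then show ?thesis unfolding N_def by blast
      qed
      then show False using elim by simp
    qed
    have u0: "u > 0"
    proof -
      have "u \<noteq> 0" using gen by auto
      moreover have "u \<ge> 0" by (simp add: u_def)
      ultimately show ?thesis by simp
    qed
    have mem: "x \<in> packet_band M j ?p \<longleftrightarrow> real ?p * pi \<le> real M ^ j * x \<and> real M ^ j * x \<le> (real ?p + 1) * pi" for x
      using Mj by (simp add: packet_band_def divide_le_eq le_divide_eq mult.commute)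
    have mem': "pi * u \<in> packet_band M j ?p \<longleftrightarrow> real ?p \<le> real M ^ j * u \<and> real M ^ j * u \<le> real ?p + 1"
    proof -
      have "real M ^ j * (pi * u) = (real M ^ j * u) * pi" by simp
      then show ?thesis unfolding mem by (simp only: mult_le_cancel_right_pos[OF pi_gt_zero])
    qed
    have neg: "x \<notin> packet_band M j ?p" if "x < 0" for x
    proof -
      have "real M ^ j * x < 0" using that Mj by (simp add: mult_pos_neg)
      moreover have "real ?p * pi \<ge> 0" by simp
      ultimately show ?thesis unfolding mem by linarith
    qed
    have ind: "indicator (packet_band M j ?p) \<omega> + indicator (packet_band M j ?p) (- \<omega>)
      = (of_bool (pi * u \<in> packet_band M j ?p) :: real)"
    proof (cases "\<omega> \<ge> 0")
      case True
      then have "\<omega> = pi * u" "- \<omega> < 0" using absw u0 by auto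
      then show ?thesis using neg[of "- \<omega>"] by (auto simp: indicator_def)
    next
      case False
      then have "- \<omega> = pi * u" "\<omega> < 0" using absw by auto
      then show ?thesis using neg[of "\<omega>"] by (auto simp: indicator_def)
    qed
    have abs_filter: "shannon_filter M k (c * \<omega>) = shannon_filter M k (c * (pi * u))" for c k
    proof (cases "\<omega> \<ge> 0")
      case False
      then have "pi * u = - \<omega>" using absw by simp
      then show ?thesis by (simp add: shannon_filter_minus)
    qed (use absw in simp)
    have prod: "(\<Prod>l=1..j. shannon_filter M (packet_digit M j (node_index M m j) l) (real M ^ (l - 1) * \<omega>))
      = (\<Prod>l=1..j. shannon_filter M (m l) (real M ^ (l - 1) * (pi * u)))"
    proof (intro prod.cong refl)
      fix l assume l: "l \<in> {1..j}"
      have "packet_digit M j (node_index M m j) l = m l"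
        by (rule packet_digit_node_index[OF _ l]) (simp add: m)
      then show "shannon_filter M (packet_digit M j (node_index M m j) l) (real M ^ (l - 1) * \<omega>)
        = shannon_filter M (m l) (real M ^ (l - 1) * (pi * u))" by (simp only: abs_filter)
    qed
    have sq: "(real M powr (real j / 2))\<^sup>2 = real M ^ j"
      using M by (simp add: power2_eq_square powr_realpow flip: powr_add)
    show ?case
    proof (cases "u < 1")
      case True
      have "\<bar>\<omega>\<bar> \<le> pi" using True absw by simp
      then have "\<omega> \<in> {-pi..pi}" by auto
      moreover have prod': "(\<Prod>l=1..j. shannon_filter M (packet_digit M j (node_index M m j) l) (real M ^ (l - 1) * \<omega>))
        = of_bool (real ?p \<le> real M ^ j * u \<and> real M ^ j * u \<le> real ?p + 1)"
        unfolding prod by (rule prod_shannon_filter[OF M m u0 True gen])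
      ultimately show ?thesis
        unfolding shannon_packet_ft_def prod' ind mem' by (simp add: power_mult_distrib sq)
    next
      case False
      have "u \<noteq> 1" using gen by auto
      then have u1: "u > 1" using False by simp
      then have "pi * 1 < pi * u" by (intro mult_strict_left_mono) auto
      then have "\<bar>\<omega>\<bar> > pi" using absw by simp
      then have "\<omega> \<notin> {-pi..pi}" by auto
      \<comment> \<open>Beyond the cutoff the indicators vanish too, since the band ends at pi or
        before.\<close>
      moreover have "\<not> (real M ^ j * u \<le> real ?p + 1)"
      proof -
        have "real ?p + 1 \<le> real M ^ j"
          using packet_perm_node_index_less[of M m j, OF M m] by (metis Suc_eq_plus1 Suc_leI of_nat_1 of_nat_add of_nat_le_iff of_nat_power)
        also have "\<dots> < real M ^ j * u" using u1 Mj by simp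
        finally show ?thesis by simp
      qed
      ultimately show ?thesis
        unfolding shannon_packet_ft_def ind mem' by simp
    qed
  qed
qed

text \<open>\<open>lim\<close> is meaningful only once convergence is known. Nested compact
  intervals provide it: left ends increase, right ends decrease, and every left end is below every
  right end.\<close>

lemma path_frequency_in_band:
  assumes M: "2 \<le> M" and m: "\<And>l. l \<ge> 1 \<Longrightarrow> m l < M"
  shows "path_frequency M m \<in> packet_band M j (packet_perm M (node_index M m j))"
proof -
  define p where "p j = packet_perm M (node_index M m j)" for j
  define a where "a j = real (p j) * pi / real M ^ j" for j
  define b where "b j = (real (p j) + 1) * pi / real M ^ j" for j
  have M0: "real M > 0" using M by simp
  have step: "real M * real (p j) \<le> real (p (Suc j))" "real (p (Suc j)) + 1 \<le> real M * (real (p j) + 1)" for j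
  proof -
    have "m (Suc j) < M" by (rule m) simp
    from packet_perm_node_index_bounds[of M m j, OF M this, THEN of_nat_mono[where 'a=real]]
    show "real M * real (p j) \<le> real (p (Suc j))" "real (p (Suc j)) + 1 \<le> real M * (real (p j) + 1)"
      by (simp_all add: p_def algebra_simps)
  qed
  have inc: "incseq a"
  proof (rule incseq_SucI)
    fix j
    have "a j = (real M * real (p j)) * pi / real M ^ Suc j" using M0 by (simp add: a_def)
    also have "\<dots> \<le> a (Suc j)" unfolding a_def using step(1)[of j] by (intro divide_right_mono mult_right_mono) auto
    finally show "a j \<le> a (Suc j)" .
  qed
  have dec: "decseq b"
  proof (rule decseq_SucI)
    fix j
    have "b (Suc j) \<le> (real M * (real (p j) + 1)) * pi / real M ^ Suc j"
      unfolding b_def using step(2)[of j] by (intro divide_right_mono mult_right_mono) auto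
    also have "\<dots> = b j" using M0 by (simp add: b_def)
    finally show "b (Suc j) \<le> b j" .
  qed
  have ab: "a j \<le> b j" for j unfolding a_def b_def by (intro divide_right_mono mult_right_mono) auto
  have bd: "a i \<le> b j" for i j
  proof -
    have "a i \<le> a (max i j)" using inc by (simp add: incseqD)
    also have "\<dots> \<le> b (max i j)" by (rule ab)
    also have "\<dots> \<le> b j" using dec by (simp add: decseqD)
    finally show ?thesis .
  qed
  obtain L where L: "a \<longlonglongrightarrow> L" using incseq_convergent[OF inc, of "b 0"] bd by metis
  have "path_frequency M m = L" unfolding path_frequency_def using limI[OF L] by (simp add: a_def[abs_def] p_def)
  moreover have "a j \<le> L" by (rule incseq_le[OF inc L])
  moreover have "L \<le> b j" using bd by (intro LIMSEQ_le_const2[OF L]) auto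
  ultimately show ?thesis by (simp add: packet_band_def a_def b_def p_def)
qed

section \<open>Averages of the spectrum over shrinking bands\<close>

text \<open>Symmetric windows make each truncated transform exactly even, so \<open>g\<close> and
  its reflection are L2 limits of the same family and agree almost everywhere.\<close>

lemma has_fourier_transform_even:
  assumes ft: "has_fourier_transform f g" and ev: "\<And>t. f (- t) = f t"
  shows "AE \<omega> in lebesgue. g (- \<omega>) = g \<omega>"
proof -
  have f2: "square_integrable lebesgue f" and g2: "square_integrable lebesgue g"
    and lim: "tendsto_L2 lebesgue (\<lambda>T. truncated_fourier T f) g at_top"
    using ft by (simp_all add: has_fourier_transform_def truncated_fourier_def[abs_def])
  have fm: "f \<in> borel_measurable lebesgue" and gm[measurable]: "g \<in> borel_measurable lebesgue"
    using f2 g2 by (simp_all add: square_integrable_def)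
  have neg: "(\<lambda>x::real. - x) \<in> lebesgue \<rightarrow>\<^sub>M lebesgue"
    using lebesgue_affine_measurable[where c="\<lambda>x::real. -1" and t=0] by simp
  have gn[measurable]: "(\<lambda>\<omega>. g (- \<omega>)) \<in> borel_measurable lebesgue" by (rule measurable_compose[OF neg gm])
  have tm[measurable]: "truncated_fourier T f \<in> borel_measurable lebesgue" for T by (rule truncated_fourier_measurable[OF fm])
  have tn[measurable]: "(\<lambda>\<omega>. truncated_fourier T f (- \<omega>)) \<in> borel_measurable lebesgue" for T by (rule measurable_compose[OF neg tm])
  have sym: "truncated_fourier T f (- \<omega>) = truncated_fourier T f \<omega>" for T \<omega>
  proof -
    have "truncated_fourier T f (- \<omega>) = (\<integral>t. (indicator {-T..T} (0 + (-1) * t) * f (0 + (-1) * t)) * cis (-1 * (- \<omega> * (0 + (-1) * t))) \<partial>lebesgue)"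
      unfolding truncated_fourier_eq by (subst lebesgue_integral_real_affine[where c="-1" and t=0]) simp_all
    also have "\<dots> = truncated_fourier T f \<omega>"
      unfolding truncated_fourier_eq
      by (rule Bochner_Integration.integral_cong) (auto simp: ev split: split_indicator)
    finally show ?thesis .
  qed
  define e where "e T = (\<integral>\<^sup>+\<omega>. ennreal ((norm (truncated_fourier T f \<omega> - g \<omega>))\<^sup>2) \<partial>lebesgue)" for T
  have e: "(e \<longlongrightarrow> 0) at_top" using lim by (simp add: tendsto_L2_def e_def[abs_def])
  have e': "(\<integral>\<^sup>+\<omega>. ennreal ((norm (truncated_fourier T f (- \<omega>) - g (- \<omega>)))\<^sup>2) \<partial>lebesgue) = e T" for T
    unfolding e_def by (subst (2) nn_integral_real_affine_lebesgue[where c="-1" and t=0]) simp_all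
  define I where "I = (\<integral>\<^sup>+\<omega>. ennreal ((norm (g (- \<omega>) - g \<omega>))\<^sup>2) \<partial>lebesgue)"
  have le: "I \<le> ennreal 2 * e T + ennreal 2 * e T" for T
  proof -
    have "I \<le> (\<integral>\<^sup>+\<omega>. ennreal 2 * ennreal ((norm (truncated_fourier T f \<omega> - g \<omega>))\<^sup>2)
        + ennreal 2 * ennreal ((norm (truncated_fourier T f (- \<omega>) - g (- \<omega>)))\<^sup>2) \<partial>lebesgue)"
      unfolding I_def
    proof (rule nn_integral_mono)
      fix \<omega> :: real
      define x where "x = norm (truncated_fourier T f \<omega> - g \<omega>)"
      define y where "y = norm (truncated_fourier T f (- \<omega>) - g (- \<omega>))"
      have "norm (g (- \<omega>) - g \<omega>) = norm ((truncated_fourier T f \<omega> - g \<omega>) - (truncated_fourier T f (- \<omega>) - g (- \<omega>)))"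
        by (simp add: sym)
      also have "\<dots> \<le> x + y" unfolding x_def y_def by (rule norm_triangle_ineq4)
      finally have "(norm (g (- \<omega>) - g \<omega>))\<^sup>2 \<le> (x + y)\<^sup>2" by (rule power_mono) simp
      also have "\<dots> \<le> 2 * x\<^sup>2 + 2 * y\<^sup>2"
        using sum_squares_bound[of x y] by (simp add: power2_eq_square algebra_simps)
      finally show "ennreal ((norm (g (- \<omega>) - g \<omega>))\<^sup>2) \<le> ennreal 2 * ennreal ((norm (truncated_fourier T f \<omega> - g \<omega>))\<^sup>2)
        + ennreal 2 * ennreal ((norm (truncated_fourier T f (- \<omega>) - g (- \<omega>)))\<^sup>2)"
        unfolding x_def[symmetric] y_def[symmetric]
        by (subst ennreal_mult[symmetric], simp, simp)+ (simp add: ennreal_plus[symmetric] ennreal_leI del: ennreal_plus)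
    qed
    also have "\<dots> = ennreal 2 * e T + ennreal 2 * e T"
      by (subst nn_integral_add, measurable, subst nn_integral_cmult, measurable, subst nn_integral_cmult, measurable)
        (simp only: e', simp only: e_def)
    finally show ?thesis .
  qed
  then have le2: "I \<le> 2 * e T + 2 * e T" for T by simp
  have "((\<lambda>T. 2 * e T + 2 * e T) \<longlongrightarrow> 2 * 0 + 2 * 0) at_top"
    by (intro tendsto_add tendsto_mult_ennreal tendsto_const e) auto
  then have "I \<le> 2 * 0 + 2 * 0"
    by (rule tendsto_lowerbound) (simp_all only: le2 eventually_True trivial_limit_at_top_linorder not_False_eq_True)
  then have "I = 0" by simp
  then have "AE \<omega> in lebesgue. ennreal ((norm (g (- \<omega>) - g \<omega>))\<^sup>2) = 0"
    unfolding I_def by (subst (asm) nn_integral_0_iff_AE) measurable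
  then show ?thesis by eventually_elim simp
qed

text \<open>The antiderivative is a multiple of sin (N k \<omega>), and N k \<omega> is a multiple
  of pi at both ends. The band covers |k| / 2 periods, so for odd k the integral vanishes by the
  position of the ends, not by the length alone.\<close>

lemma integral_band_cos:
  assumes N: "N > 0"
  shows "(\<integral>\<omega>. indicator {real p * pi / N .. (real p + 1) * pi / N} \<omega> * cos (\<omega> * (N * of_int k)) \<partial>lebesgue)
    = of_bool (k = 0) * pi / N"
proof -
  let ?a = "real p * pi / N" and ?b = "(real p + 1) * pi / N"
  have ab: "?a \<le> ?b" using N by (simp add: divide_right_mono)
  let ?f = "\<lambda>\<omega>. cos (\<omega> * (N * of_int k)) :: real"
  have m: "(\<lambda>\<omega>. indicator {?a..?b} \<omega> * ?f \<omega>) \<in> borel_measurable lborel" by measurable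
  have "(\<integral>\<omega>. indicator {?a..?b} \<omega> * ?f \<omega> \<partial>lebesgue) = (\<integral>\<omega>. indicator {?a..?b} \<omega> *\<^sub>R ?f \<omega> \<partial>lborel)"
    using integral_completion[OF m] by simp
  also have "\<dots> = of_bool (k = 0) * pi / N"
  proof (cases "k = 0")
    case True
    have "(\<integral>\<omega>. indicator {?a..?b} \<omega> *\<^sub>R ?f \<omega> \<partial>lborel) = ?b - ?a"
      by (rule integral_FTC_atLeastAtMost[where F="\<lambda>x. x", OF ab]) (auto simp: True intro!: derivative_eq_intros)
    also have "\<dots> = pi / N" using N by (simp add: field_simps)
    finally show ?thesis using True by (simp only: simp_thms of_bool_eq mult_1)
  next
    case False
    let ?c = "N * of_int k"
    have c: "?c \<noteq> 0" using N False by simp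
    have "(\<integral>\<omega>. indicator {?a..?b} \<omega> *\<^sub>R ?f \<omega> \<partial>lborel) = sin (?b * ?c) / ?c - sin (?a * ?c) / ?c"
    proof (rule integral_FTC_atLeastAtMost[OF ab])
      fix x :: real
      show "((\<lambda>x. sin (x * ?c) / ?c) has_vector_derivative cos (x * ?c)) (at x within {?a..?b})"
        unfolding has_real_derivative_iff_has_vector_derivative[symmetric]
        using c by (auto intro!: derivative_eq_intros)
    qed (intro continuous_intros)
    moreover have "?b * ?c = of_int ((int p + 1) * k) * pi" "?a * ?c = of_int (int p * k) * pi"
      using N by (simp_all add: field_simps)
    moreover have "sin (of_int z * pi) = 0" for z :: int unfolding sin_zero_iff_int2 by blast
    ultimately have "(\<integral>\<omega>. indicator {?a..?b} \<omega> *\<^sub>R ?f \<omega> \<partial>lborel) = 0"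
      by (simp only: div_0 diff_self)
    then show ?thesis using False by (simp only: of_bool_eq simp_thms mult_zero_left div_0)
  qed
  finally show ?thesis .
qed

text \<open>Evenness of the spectrum folds the band at negative frequencies onto the positive one,
  which turns 1 / (2 pi) into 1 / pi; the factor M^j is the squared amplitude of the packet.\<close>

lemma autocorrelation_packet_coefficients:
  fixes M :: nat and P :: "'a measure" and X :: "real \<Rightarrow> 'a \<Rightarrow> real" and \<gamma> :: "real \<Rightarrow> real"
  assumes M: "M \<ge> 2" and m: "\<And>l. l \<ge> 1 \<Longrightarrow> m l < M"
    and X: "\<And>t. square_integrable P (X t)"
    and \<gamma>: "integrable lebesgue \<gamma>" "square_integrable lebesgue \<gamma>" "AE \<omega> in lebesgue. \<bar>\<gamma> \<omega>\<bar> \<le> B"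
      "AE \<omega> in lebesgue. \<gamma> (- \<omega>) = \<gamma> \<omega>"
    and R: "\<And>t s. complex_of_real (\<integral>x. X t x * X s x \<partial>P)
      = 1 / (2 * pi) * (\<integral>\<omega>. complex_of_real (\<gamma> \<omega>) * cis (\<omega> * (t - s)) \<partial>lebesgue)"
    and w: "shannon_packet M j (node_index M m j) w"
    and c: "packet_coefficients P X M j w c"
  shows "autocorrelation P c k = real M ^ j / pi *
    (\<integral>\<omega>. indicator (packet_band M j (packet_perm M (node_index M m j))) \<omega> * (\<gamma> \<omega> * cos (\<omega> * (real M ^ j * of_int k))) \<partial>lebesgue)"
proof -
  let ?A = "packet_band M j (packet_perm M (node_index M m j))"
  let ?v = "shannon_packet_ft M j (node_index M m j)"
  let ?N = "real M ^ j"
  let ?a = "?N * of_int k"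
  note measurable_ident_lebesgue[measurable]
  have \<gamma>m[measurable]: "\<gamma> \<in> borel_measurable lebesgue" using \<gamma>(1) by simp
  have A: "?A \<in> sets lebesgue" by (simp add: packet_band_def)
  have w': "has_fourier_transform (\<lambda>t. of_real (w t)) (\<lambda>\<omega>. complex_of_real (?v \<omega>))"
    using w by (simp add: shannon_packet_def)
  have vm[measurable]: "?v \<in> borel_measurable lebesgue"
    using w' measurable_compose[of "\<lambda>\<omega>. complex_of_real (?v \<omega>)" lebesgue borel Re borel]
    by (simp add: has_fourier_transform_def square_integrable_def)
  have "complex_of_real (\<integral>x. c k x * c 0 x \<partial>P)
    = 1 / (2 * pi) * (\<integral>\<omega>. complex_of_real (\<gamma> \<omega>) * cis (\<omega> * ?a) * of_real ((norm (complex_of_real (?v \<omega>)))\<^sup>2) \<partial>lebesgue)"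
  proof (rule expectation_packet_coefficients[OF X _ _ _ R w'])
    show "integrable lebesgue (\<lambda>\<omega>. complex_of_real (\<gamma> \<omega>))" using \<gamma>(1) by simp
    show "square_integrable lebesgue (\<lambda>\<omega>. complex_of_real (\<gamma> \<omega>))" using \<gamma>(2) by (simp add: square_integrable_def)
    show "AE \<omega> in lebesgue. norm (complex_of_real (\<gamma> \<omega>)) \<le> B" using \<gamma>(3) by simp
    show "has_qm_integral P (\<lambda>t x. X t x * w (t - ?N * of_int k)) (c k)"
      using c by (simp add: packet_coefficients_def)
    show "has_qm_integral P (\<lambda>t x. X t x * w t) (c 0)"
      using c[unfolded packet_coefficients_def, rule_format, of 0] by simp
  qed
  also have "(\<integral>\<omega>. complex_of_real (\<gamma> \<omega>) * cis (\<omega> * ?a) * of_real ((norm (complex_of_real (?v \<omega>)))\<^sup>2) \<partial>lebesgue)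
    = (\<integral>\<omega>. complex_of_real (?N * (indicator ?A \<omega> + indicator ?A (- \<omega>))) * (complex_of_real (\<gamma> \<omega>) * cis (\<omega> * ?a)) \<partial>lebesgue)"
    (is "_ = integral\<^sup>L lebesgue ?h")
  proof (rule integral_cong_AE)
    have sq: "AE \<omega> in lebesgue. (?v \<omega>)\<^sup>2 = ?N * (indicator ?A \<omega> + indicator ?A (- \<omega>))"
      by (rule shannon_packet_ft_squared_AE[OF M m])
    have An[measurable]: "(\<lambda>\<omega>. indicator ?A (- \<omega>) :: real) \<in> borel_measurable lebesgue"
      by (rule borel_imp_lebesgue_measurable) (simp add: packet_band_def)
    have Am[measurable]: "(\<lambda>\<omega>. indicator ?A \<omega> :: real) \<in> borel_measurable lebesgue"
      using A by (rule borel_measurable_indicator)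
    show "?h \<in> borel_measurable lebesgue" by measurable
    show "(\<lambda>\<omega>. complex_of_real (\<gamma> \<omega>) * cis (\<omega> * ?a) * of_real ((norm (complex_of_real (?v \<omega>)))\<^sup>2)) \<in> borel_measurable lebesgue"
      by measurable
    show "AE \<omega> in lebesgue. complex_of_real (\<gamma> \<omega>) * cis (\<omega> * ?a) * of_real ((norm (complex_of_real (?v \<omega>)))\<^sup>2) = ?h \<omega>"
      using sq
    proof eventually_elim
      case (elim \<omega>)
      have "(norm (complex_of_real (?v \<omega>)))\<^sup>2 = (?v \<omega>)\<^sup>2" by simp
      then show ?case unfolding elim by (simp only: mult.commute)
    qed
  qed
  finally have E: "complex_of_real (autocorrelation P c k) = complex_of_real (1 / (2 * pi)) * integral\<^sup>L lebesgue ?h"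
    by (simp add: autocorrelation_def)
  have cosm[measurable]: "(\<lambda>\<omega>. cos (\<omega> * ?a)) \<in> borel_measurable lebesgue"
    by (rule borel_imp_lebesgue_measurable) measurable
  let ?g = "\<lambda>\<omega>. \<gamma> \<omega> * cos (\<omega> * ?a)"
  have gi: "integrable lebesgue ?g"
    by (rule Bochner_Integration.integrable_bound[OF \<gamma>(1)]) (auto simp: abs_mult mult_left_le intro!: AE_I2)
  have i1: "integrable lebesgue (\<lambda>\<omega>. indicator ?A \<omega> * ?g \<omega>)"
    using integrable_mult_indicator[OF A gi] by simp
  \<comment> \<open>Substitution \<omega> -> - \<omega>. The spectrum is even only almost
    everywhere, so the integrands are compared up to null sets.\<close>
  have refl: "(\<integral>\<omega>. indicator ?A (- \<omega>) * ?g \<omega> \<partial>lebesgue) = (\<integral>\<omega>. indicator ?A \<omega> * ?g \<omega> \<partial>lebesgue)"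
    and i2: "integrable lebesgue (\<lambda>\<omega>. indicator ?A (- \<omega>) * ?g \<omega>)"
  proof -
    have neg: "(\<lambda>x::real. - x) \<in> lebesgue \<rightarrow>\<^sub>M lebesgue"
      using lebesgue_affine_measurable[where c="\<lambda>x::real. -1" and t=0] by simp
    have \<gamma>n: "(\<lambda>\<omega>. \<gamma> (- \<omega>)) \<in> borel_measurable lebesgue" by (rule measurable_compose[OF neg \<gamma>m])
    have Am: "(\<lambda>\<omega>. indicator ?A \<omega> :: real) \<in> borel_measurable lebesgue"
      using A by (rule borel_measurable_indicator)
    have "(\<integral>\<omega>. indicator ?A (- \<omega>) * ?g \<omega> \<partial>lebesgue) = (\<integral>\<omega>. indicator ?A \<omega> * (\<gamma> (- \<omega>) * cos (\<omega> * ?a)) \<partial>lebesgue)"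
      by (subst lebesgue_integral_real_affine[where c="-1" and t=0]) simp_all
    also have "\<dots> = (\<integral>\<omega>. indicator ?A \<omega> * ?g \<omega> \<partial>lebesgue)"
    proof (rule integral_cong_AE)
      show "(\<lambda>\<omega>. indicator ?A \<omega> * (\<gamma> (- \<omega>) * cos (\<omega> * ?a))) \<in> borel_measurable lebesgue"
        using \<gamma>n Am cosm by (intro borel_measurable_times)
      show "(\<lambda>\<omega>. indicator ?A \<omega> * ?g \<omega>) \<in> borel_measurable lebesgue"
        using \<gamma>m Am cosm by (intro borel_measurable_times)
      show "AE \<omega> in lebesgue. indicator ?A \<omega> * (\<gamma> (- \<omega>) * cos (\<omega> * ?a)) = indicator ?A \<omega> * ?g \<omega>"
        using \<gamma>(4) by eventually_elim (simp only:)
    qed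
    finally show "(\<integral>\<omega>. indicator ?A (- \<omega>) * ?g \<omega> \<partial>lebesgue) = (\<integral>\<omega>. indicator ?A \<omega> * ?g \<omega> \<partial>lebesgue)" .
    have "uminus ` ?A = {- ((real (packet_perm M (node_index M m j)) + 1) * pi / ?N) .. - (real (packet_perm M (node_index M m j)) * pi / ?N)}"
      by (simp add: packet_band_def)
    then have A': "uminus ` ?A \<in> sets lebesgue" by simp
    have "indicator ?A (- \<omega>) = (indicator (uminus ` ?A) \<omega> :: real)" for \<omega>
      by (force simp: indicator_def image_iff)
    then show "integrable lebesgue (\<lambda>\<omega>. indicator ?A (- \<omega>) * ?g \<omega>)"
      using integrable_mult_indicator[OF A' gi] by simp
  qed
  have hi: "integrable lebesgue ?h"
  proof -
    have \<gamma>c: "integrable lebesgue (\<lambda>\<omega>. complex_of_real (\<gamma> \<omega>))" using \<gamma>(1) by simp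
    have An: "(\<lambda>\<omega>. indicator ?A (- \<omega>) :: real) \<in> borel_measurable lebesgue"
      by (rule borel_imp_lebesgue_measurable) (simp add: packet_band_def)
    have Am: "(\<lambda>\<omega>. indicator ?A \<omega> :: real) \<in> borel_measurable lebesgue"
      using A by (rule borel_measurable_indicator)
    note An[measurable] Am[measurable]
    have "integrable lebesgue (\<lambda>\<omega>. complex_of_real (\<gamma> \<omega>) * (complex_of_real (?N * (indicator ?A \<omega> + indicator ?A (- \<omega>))) * cis (\<omega> * ?a)))"
    proof (rule integrable_mult_bounded[OF \<gamma>c])
      show "(\<lambda>\<omega>. complex_of_real (?N * (indicator ?A \<omega> + indicator ?A (- \<omega>))) * cis (\<omega> * ?a)) \<in> borel_measurable lebesgue" by measurable
      show "norm (complex_of_real (?N * (indicator ?A \<omega> + indicator ?A (- \<omega>))) * cis (\<omega> * ?a)) \<le> ?N * 2" for \<omega>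
        by (auto simp: norm_mult norm_power split: split_indicator)
    qed
    then show ?thesis by (simp only: mult.left_commute)
  qed
  \<comment> \<open>The autocorrelation is real, so taking real parts replaces \<open>cis\<close> by
    the cosine.\<close>
  have "autocorrelation P c k = Re (complex_of_real (1 / (2 * pi)) * integral\<^sup>L lebesgue ?h)"
    unfolding E[symmetric] by simp
  also have "\<dots> = 1 / (2 * pi) * Re (integral\<^sup>L lebesgue ?h)" by simp
  also have "Re (integral\<^sup>L lebesgue ?h) = (\<integral>\<omega>. Re (?h \<omega>) \<partial>lebesgue)"
    by (rule integral_Re[OF hi, symmetric])
  also have "\<dots> = (\<integral>\<omega>. ?N * (indicator ?A \<omega> * ?g \<omega> + indicator ?A (- \<omega>) * ?g \<omega>) \<partial>lebesgue)"
    by (rule Bochner_Integration.integral_cong) (simp_all add: distrib_right)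
  also have "\<dots> = ?N * ((\<integral>\<omega>. indicator ?A \<omega> * ?g \<omega> \<partial>lebesgue) + (\<integral>\<omega>. indicator ?A (- \<omega>) * ?g \<omega> \<partial>lebesgue))"
    by (subst integral_mult_right_zero, subst Bochner_Integration.integral_add[OF i1 i2]) (rule HOL.refl)
  also have "\<dots> = 2 * ?N * (\<integral>\<omega>. indicator ?A \<omega> * ?g \<omega> \<partial>lebesgue)" unfolding refl by simp
  finally show ?thesis by simp
qed

text \<open>Subtract y times the exact band integral of the cosine; the remainder is at most e times
  the band length pi / M^j, which the prefactor cancels. The bound e is the same for all k.\<close>

lemma band_average_close:
  fixes \<gamma> :: "real \<Rightarrow> real"
  assumes M: "M \<ge> 2" and \<gamma>: "integrable lebesgue \<gamma>"
    and close: "\<And>\<omega>. \<omega> \<in> packet_band M j p \<Longrightarrow> \<bar>\<gamma> \<omega> - y\<bar> \<le> e"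
  shows "\<bar>real M ^ j / pi * (\<integral>\<omega>. indicator (packet_band M j p) \<omega> * (\<gamma> \<omega> * cos (\<omega> * (real M ^ j * of_int k))) \<partial>lebesgue)
    - y * of_bool (k = 0)\<bar> \<le> e"
proof -
  let ?A = "packet_band M j p" and ?N = "real M ^ j"
  let ?C = "\<lambda>\<omega>. cos (\<omega> * (?N * of_int k))"
  have N: "?N > 0" using M by simp
  have [measurable]: "\<gamma> \<in> borel_measurable lebesgue" using \<gamma> by simp
  have cosm[measurable]: "?C \<in> borel_measurable lebesgue"
    by (rule borel_imp_lebesgue_measurable) measurable
  have A: "?A \<in> sets lebesgue" by (simp add: packet_band_def)
  have gi: "integrable lebesgue (\<lambda>\<omega>. \<gamma> \<omega> * ?C \<omega>)"
    by (rule Bochner_Integration.integrable_bound[OF \<gamma>]) (auto simp: abs_mult mult_left_le intro!: AE_I2)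
  have i1: "integrable lebesgue (\<lambda>\<omega>. indicator ?A \<omega> * (\<gamma> \<omega> * ?C \<omega>))"
    using integrable_mult_indicator[OF A gi] by simp
  have iA: "integrable lebesgue (\<lambda>\<omega>. indicator ?A \<omega> :: real)"
    unfolding packet_band_def by (rule integrable_indicator_interval)
  have i2: "integrable lebesgue (\<lambda>\<omega>. indicator ?A \<omega> * ?C \<omega>)"
    by (rule Bochner_Integration.integrable_bound[OF iA])
      (use iA in \<open>auto simp: abs_mult mult_left_le intro!: AE_I2 borel_measurable_times[OF borel_measurable_integrable]\<close>)
  have cos: "(\<integral>\<omega>. indicator ?A \<omega> * ?C \<omega> \<partial>lebesgue) = of_bool (k = 0) * pi / ?N"
    unfolding packet_band_def by (rule integral_band_cos[OF N])
  have len: "(\<integral>\<omega>. indicator ?A \<omega> \<partial>lebesgue) = pi / ?N"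
    using integral_band_cos[OF N, of p 0] by (simp only: packet_band_def) simp
  have "(\<integral>\<omega>. indicator ?A \<omega> * (\<gamma> \<omega> * ?C \<omega>) \<partial>lebesgue) - y * (of_bool (k = 0) * pi / ?N)
    = (\<integral>\<omega>. indicator ?A \<omega> * (\<gamma> \<omega> * ?C \<omega>) - y * (indicator ?A \<omega> * ?C \<omega>) \<partial>lebesgue)"
    unfolding cos[symmetric] using i1 i2 by (subst Bochner_Integration.integral_diff) simp_all
  also have "\<bar>\<dots>\<bar> \<le> (\<integral>\<omega>. e * indicator ?A \<omega> \<partial>lebesgue)"
  proof (rule order_trans[OF integral_abs_bound integral_mono])
    show "integrable lebesgue (\<lambda>\<omega>. \<bar>indicator ?A \<omega> * (\<gamma> \<omega> * ?C \<omega>) - y * (indicator ?A \<omega> * ?C \<omega>)\<bar>)"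
      using i1 i2 by simp
    show "integrable lebesgue (\<lambda>\<omega>. e * indicator ?A \<omega>)" using iA by simp
    show "\<bar>indicator ?A \<omega> * (\<gamma> \<omega> * ?C \<omega>) - y * (indicator ?A \<omega> * ?C \<omega>)\<bar> \<le> e * indicator ?A \<omega>" for \<omega>
    proof (cases "\<omega> \<in> ?A")
      case True
      have "\<bar>(\<gamma> \<omega> - y) * ?C \<omega>\<bar> \<le> e * 1"
        unfolding abs_mult using close[OF True] by (intro mult_mono) auto
      then show ?thesis using True by (simp add: left_diff_distrib)
    qed simp
  qed
  also have "\<dots> = e * (pi / ?N)" using len by simp
  finally have b: "\<bar>(\<integral>\<omega>. indicator ?A \<omega> * (\<gamma> \<omega> * ?C \<omega>) \<partial>lebesgue) - y * (of_bool (k = 0) * pi / ?N)\<bar> \<le> e * (pi / ?N)" .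
  have "?N / pi * (\<integral>\<omega>. indicator ?A \<omega> * (\<gamma> \<omega> * ?C \<omega>) \<partial>lebesgue) - y * of_bool (k = 0)
    = ?N / pi * ((\<integral>\<omega>. indicator ?A \<omega> * (\<gamma> \<omega> * ?C \<omega>) \<partial>lebesgue) - y * (of_bool (k = 0) * pi / ?N))"
    unfolding right_diff_distrib using N by simp
  also have "\<bar>\<dots>\<bar> \<le> ?N / pi * (e * (pi / ?N))"
    unfolding abs_mult using N b by (intro mult_mono) auto
  also have "\<dots> = e" using N by simp
  finally show ?thesis .
qed

section \<open>The autocorrelation as inverse transform of the spectrum\<close>

text \<open>Supplies what \<open>Fourier_inversion\<close> asks for: R(t) = E[X(t) X(0)] is
  continuous because the process is so in quadratic mean, and bounded because stationarity fixes the
  second moment. Symmetry of the product makes R, and hence \<gamma>, even.\<close>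

lemma autocorrelation_spectral:
  fixes X :: "real \<Rightarrow> 'a \<Rightarrow> real" and \<gamma> :: "real \<Rightarrow> real"
  assumes wss: "wide_sense_stationary P X" and qm: "continuous_in_quadratic_mean P X"
    and ft: "has_fourier_transform (\<lambda>t. of_real (autocorrelation P X t)) (\<lambda>\<omega>. of_real (\<gamma> \<omega>))"
    and \<gamma>: "integrable lebesgue \<gamma>"
  shows "complex_of_real (\<integral>x. X t x * X s x \<partial>P)
      = 1 / (2 * pi) * (\<integral>\<omega>. complex_of_real (\<gamma> \<omega>) * cis (\<omega> * (t - s)) \<partial>lebesgue)"
    and "AE \<omega> in lebesgue. \<gamma> (- \<omega>) = \<gamma> \<omega>"
proof -
  let ?R = "autocorrelation P X"
  have X2: "square_integrable P (X t)" for t using wss by (simp add: wide_sense_stationary_def)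
  have Xm: "X t \<in> borel_measurable P" for t using X2 by (simp add: square_integrable_def)
  have R: "(\<integral>x. X t x * X s x \<partial>P) = ?R (t - s)" for t s
    using wss by (simp add: wide_sense_stationary_def)
  have even: "?R (- t) = ?R t" for t
    using R[of 0 t] R[of t 0] by (simp add: mult.commute)
  have cont: "continuous_on UNIV ?R"
    unfolding continuous_on_eq_continuous_at[OF open_UNIV] isCont_def autocorrelation_def
  proof (intro ballI tendsto_L2_integral_mult tendsto_L2_const X2 Xm)
    show "tendsto_L2 P X (X t) (at t)" for t using qm by (simp add: continuous_in_quadratic_mean_def)
  qed
  \<comment> \<open>|x y| \<le> (x^2 + y^2) / 2 suffices, as both second moments equal R(0).\<close>
  have bound: "norm (complex_of_real (?R t)) \<le> ?R 0" for t
  proof -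
    have "\<bar>?R t\<bar> \<le> (\<integral>x. \<bar>X t x * X 0 x\<bar> \<partial>P)" unfolding autocorrelation_def by (rule integral_abs_bound)
    also have "\<dots> \<le> (\<integral>x. (X t x * X t x + X 0 x * X 0 x) / 2 \<partial>P)"
    proof (rule integral_mono)
      show "integrable P (\<lambda>x. \<bar>X t x * X 0 x\<bar>)" using square_integrable_mult[OF X2 X2] by simp
      show "integrable P (\<lambda>x. (X t x * X t x + X 0 x * X 0 x) / 2)"
        using square_integrable_mult[OF X2 X2] by simp
      show "\<bar>X t x * X 0 x\<bar> \<le> (X t x * X t x + X 0 x * X 0 x) / 2" for x
        using sum_squares_bound[of "\<bar>X t x\<bar>" "\<bar>X 0 x\<bar>"] by (simp add: abs_mult power2_eq_square)
    qed
    also have "\<dots> = ((\<integral>x. X t x * X t x \<partial>P) + (\<integral>x. X 0 x * X 0 x \<partial>P)) / 2"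
      using square_integrable_mult[OF X2 X2] by simp
    also have "\<dots> = ?R 0" unfolding R by simp
    finally show ?thesis by simp
  qed
  show "complex_of_real (\<integral>x. X t x * X s x \<partial>P)
      = 1 / (2 * pi) * (\<integral>\<omega>. complex_of_real (\<gamma> \<omega>) * cis (\<omega> * (t - s)) \<partial>lebesgue)"
    unfolding R
    by (rule Fourier_inversion[OF _ bound ft]) (use cont \<gamma> in \<open>auto intro: continuous_on_of_real\<close>)
  show "AE \<omega> in lebesgue. \<gamma> (- \<omega>) = \<gamma> \<omega>"
    using has_fourier_transform_even[OF ft] by (simp add: even)
qed

theorem theorem1:
  fixes M :: nat
    and P :: "'a measure"
    and X :: "real \<Rightarrow> 'a \<Rightarrow> real"
    and \<gamma> :: "real \<Rightarrow> real"
    and m :: "nat \<Rightarrow> nat"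
    and W :: "nat \<Rightarrow> nat \<Rightarrow> real \<Rightarrow> real"
    and c :: "nat \<Rightarrow> nat \<Rightarrow> int \<Rightarrow> 'a \<Rightarrow> real"
  assumes "M \<ge> 2"
    and "prob_space P"
    and "wide_sense_stationary P X"
    and "centred P X"
    and "continuous_in_quadratic_mean P X"
    and "has_fourier_transform (\<lambda>t. of_real (autocorrelation P X t)) (\<lambda>\<omega>. of_real (\<gamma> \<omega>))"
    and "\<gamma> \<in> borel_measurable lebesgue" and "\<exists>B. AE \<omega> in lebesgue. \<bar>\<gamma> \<omega>\<bar> \<le> B"
    and "AE \<omega> in lebesgue. \<omega> \<notin> {-pi..pi} \<longrightarrow> \<gamma> \<omega> = 0"
    and "\<And>l. l \<ge> 1 \<Longrightarrow> m l < M"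
    and "\<And>j n. j \<ge> 1 \<Longrightarrow> n < M ^ j \<Longrightarrow> shannon_packet M j n (W j n)"
    and "\<And>j n. j \<ge> 1 \<Longrightarrow> n < M ^ j \<Longrightarrow> packet_coefficients P X M j (W j n) (c j n)"
    and "isCont \<gamma> (path_frequency M m)"
  shows "uniform_limit UNIV
           (\<lambda>j k. autocorrelation P (c j (node_index M m j)) k)
           (\<lambda>k. \<gamma> (path_frequency M m) * of_bool (k = 0))
           sequentially"
proof -
  let ?L = "path_frequency M m"
  have M0: "real M > 1" using assms(1) by simp
  obtain B where B: "AE \<omega> in lebesgue. \<bar>\<gamma> \<omega>\<bar> \<le> B" using assms(8) by blast
  have \<gamma>2: "square_integrable lebesgue \<gamma>"
    using assms(6) measurable_compose[of "\<lambda>\<omega>. complex_of_real (\<gamma> \<omega>)" lebesgue borel Re borel]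
    by (simp add: has_fourier_transform_def square_integrable_def)
  \<comment> \<open>Essentially bounded and null outside a bounded interval, hence
    integrable.\<close>
  have \<gamma>1: "integrable lebesgue \<gamma>"
  proof (rule Bochner_Integration.integrable_bound)
    show "integrable lebesgue (\<lambda>\<omega>. B * indicator {-pi..pi} \<omega>)"
      by (intro integrable_mult_right integrable_indicator_interval)
    show "\<gamma> \<in> borel_measurable lebesgue" by (rule assms(7))
    show "AE \<omega> in lebesgue. norm (\<gamma> \<omega>) \<le> norm (B * indicator {-pi..pi} \<omega>)"
      using B assms(9) by eventually_elim (auto simp: indicator_def)
  qed
  have X2: "square_integrable P (X t)" for t using assms(3) by (simp add: wide_sense_stationary_def)
  note spectral = autocorrelation_spectral[OF assms(3,5,6) \<gamma>1]
  show ?thesis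
  proof (rule uniform_limitI)
    fix e :: real assume e: "e > 0"
    \<comment> \<open>Half of e restores the strict inequality, since the band average preserves
      only \<le>.\<close>
    obtain d where d: "d > 0" "\<And>\<omega>. \<bar>\<omega> - ?L\<bar> < d \<Longrightarrow> \<bar>\<gamma> \<omega> - \<gamma> ?L\<bar> < e / 2"
      using assms(13)[unfolded continuous_at_eps_delta, rule_format, of "e / 2"] e by (auto simp: dist_real_def)
    have "(\<lambda>j. pi / real M ^ j) \<longlonglongrightarrow> 0"
      using M0 by (rule LIMSEQ_divide_realpow_zero)
    then have "\<forall>\<^sub>F j in sequentially. pi / real M ^ j < d" using d(1) by (rule order_tendstoD(2))
    then show "\<forall>\<^sub>F j in sequentially. \<forall>k\<in>UNIV.
        dist (autocorrelation P (c j (node_index M m j)) k) (\<gamma> ?L * of_bool (k = 0)) < e"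
      \<comment> \<open>Packets and coefficients are given from level 1 on.\<close>
      using eventually_ge_at_top[of 1]
    proof eventually_elim
      case (elim j)
      let ?n = "node_index M m j"
      have n: "?n < M ^ j" by (rule node_index_less[OF assms(1,10)])
      have close: "\<bar>\<gamma> \<omega> - \<gamma> ?L\<bar> \<le> e / 2" if "\<omega> \<in> packet_band M j (packet_perm M ?n)" for \<omega>
      proof -
        have "?L \<in> packet_band M j (packet_perm M ?n)" by (rule path_frequency_in_band[OF assms(1,10)])
        with that have "\<bar>\<omega> - ?L\<bar> \<le> (real (packet_perm M ?n) + 1) * pi / real M ^ j - real (packet_perm M ?n) * pi / real M ^ j"
          unfolding packet_band_def atLeastAtMost_iff by linarith
        also have "\<dots> = pi / real M ^ j" by (simp add: distrib_right add_divide_distrib)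
        finally have "\<bar>\<omega> - ?L\<bar> < d" using elim(1) by simp
        then show ?thesis using d(2) by (simp add: less_imp_le)
      qed
      show ?case
      proof
        fix k :: int
        have R: "autocorrelation P (c j ?n) k = real M ^ j / pi * (\<integral>\<omega>. indicator (packet_band M j (packet_perm M ?n)) \<omega>
            * (\<gamma> \<omega> * cos (\<omega> * (real M ^ j * of_int k))) \<partial>lebesgue)"
          by (rule autocorrelation_packet_coefficients[OF assms(1,10) X2 \<gamma>1 \<gamma>2 B spectral(2,1) assms(11,12)[OF elim(2) n]])
        have "\<bar>autocorrelation P (c j ?n) k - \<gamma> ?L * of_bool (k = 0)\<bar> \<le> e / 2"
          unfolding R by (rule band_average_close[OF assms(1) \<gamma>1 close])
        then show "dist (autocorrelation P (c j ?n) k) (\<gamma> ?L * of_bool (k = 0)) < e"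
          using e by (simp add: dist_real_def)
      qed
    qed
  qed
qed

end
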